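(* For an SGT $\mathscr{S}$ the following conditions are equivalent: (a) $\mathscr{S}$ is strongly [resp. weakly] right amenable; (b) for any Banach space $X$ and any homomorphism $\Phi : \mathscr{S} \ni s \mapsto T_s \in \mathscr{L}(X)$ continuous in the weak [resp. strong] operator topology with finite quantity $M(\Phi) = \sup_{s\in\mathscr{S}} \|T_s\|$ one has: (b1) $\mathscr{N}(\Phi) \cap \mathscr{R}(\Phi) = \{0\}$, (b2) the subspace $\mathscr{D}(\Phi) = \mathscr{N}(\Phi) + \mathscr{R}(\Phi)$ is closed in $X$, and (b3) the projection $P : \mathscr{D}(\Phi) \to \mathscr{N}(\Phi)$ induced by the decomposition $\mathscr{D}(\Phi) = \mathscr{N}(\Phi) + \mathscr{R}(\Phi)$ has norm not greater than $M(\Phi)$. (The statement consists of two versions: "strongly / weak operator topology" and "weakly / strong operator topology".)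
   Context: An SGT (semigroup with topology) is a non-empty semigroup $\mathscr{S}$ that is also a (possibly non-Hausdorff) topological space; no compatibility between the multiplication and the topology is assumed. For $f:\mathscr{S}\to\mathbb{R}$ and $s\in\mathscr{S}$ let $f_s(t)=f(ts)$. $C_b(\mathscr{S})$ is the space of bounded continuous real-valued functions on $\mathscr{S}$ with the sup-norm, and $C_r(\mathscr{S})=\{f\in C_b(\mathscr{S}): f_s \text{ is continuous for every } s\in\mathscr{S}\}$. Let $C_{norm}(\mathscr{S})$ [resp. $C_{weak}(\mathscr{S})$] be the set of all $f\in C_r(\mathscr{S})$ such that $s\mapsto f_s$ and, for all $t\in\mathscr{S}$, $s\mapsto f_{st}$ are continuous from $\mathscr{S}$ to $C_r(\mathscr{S})$ equipped with its norm [resp. weak] topology. A mean on a linear subspace $\mathscr{F}$ of $C_r(\mathscr{S})$ is a linear functional $\phi:\mathscr{F}\to\mathbb{R}$ with $\inf f(\mathscr{S})\leqslant\phi(f)\leqslant\sup f(\mathscr{S})$ for all $f\in\mathscr{F}$; if $\mathscr{F}$ is right invariant ($f_s\in\mathscr{F}$ for $f\in\mathscr{F}$, $s\in\mathscr{S}$), the mean is right invariant if $\phi(f_s)=\phi(f)$ for all $f\in\mathscr{F}$, $s\in\mathscr{S}$. $\mathscr{S}$ is weakly [resp. strongly] right amenable if there is a right invariant mean on $C_{norm}(\mathscr{S})$ [resp. $C_{weak}(\mathscr{S})$]. Banach spaces are real or complex. $\mathscr{L}(X)$ is the algebra of bounded linear operators on $X$; $s\mapsto T_s$ is a homomorphism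 if $T_{st}=T_sT_t$ for all $s,t$. $\mathscr{N}(\Phi)$ and $\mathscr{R}(\Phi)$ denote, respectively, the intersection of the kernels and the closed linear span of the ranges of all operators $T_s - I$, $s\in\mathscr{S}$, where $I$ is the identity operator on $X$. The projection induced by the decomposition is $y+z\mapsto y$ for $y\in\mathscr{N}(\Phi)$, $z\in\mathscr{R}(\Phi)$. *)

theory Defs
  imports "HOL-Analysis.Analysis" "HOL-Algebra.Algebraic_Closure_Type"
begin

section \<open>Normed spaces on carrier sets\<close>

text \<open>
  Right amenability is to be characterised by a property of all real and complex Banach spaces.
  Such a quantifier cannot range over the types of class \<open>banach\<close> (which, moreover, are
  real only), so a normed space is a record with an explicit carrier: a module, in the sense of
  HOL-Algebra, over the field given by the type \<open>'k\<close> (\<open>real\<close> or \<open>complex\<close>), with a norm.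
  The components \<open>mult\<close> and \<open>one\<close> that a module record inherits from ring records
  are unconstrained and never used.
\<close>

record ('k, 'x) nvs = "('k, 'x) module" +
  vnorm :: "'x \<Rightarrow> real"

abbreviation scalars :: "'k::real_normed_field ring" where
  "scalars \<equiv> ring_of_type_algebra"

definition normed_space :: "('k::real_normed_field, 'x) nvs \<Rightarrow> bool" where
  "normed_space E \<longleftrightarrow>
     module (scalars :: 'k ring) E \<and>
     (\<forall>x\<in>carrier E. 0 \<le> vnorm E x \<and> (vnorm E x = 0 \<longleftrightarrow> x = \<zero>\<^bsub>E\<^esub>)) \<and>
     (\<forall>x\<in>carrier E. \<forall>c. vnorm E (c \<odot>\<^bsub>E\<^esub> x) = norm c * vnorm E x) \<and>
     (\<forall>x\<in>carrier E. \<forall>y\<in>carrier E. vnorm E (x \<oplus>\<^bsub>E\<^esub> y) \<le> vnorm E x + vnorm E y)"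

text \<open>The locale \<open>Metric_space\<close> wants a nonnegative symmetric distance on the whole type,
  hence the value 0 outside the carrier.\<close>

definition vdist :: "('k, 'x) nvs \<Rightarrow> 'x \<Rightarrow> 'x \<Rightarrow> real" where
  "vdist E x y =
     (if x \<in> carrier E \<and> y \<in> carrier E then vnorm E (x \<ominus>\<^bsub>E\<^esub> y) else 0)"

definition banach_space :: "('k::real_normed_field, 'x) nvs \<Rightarrow> bool" where
  "banach_space E \<longleftrightarrow> normed_space E \<and> Metric_space.mcomplete (carrier E) (vdist E)"

definition norm_topology :: "('k, 'x) nvs \<Rightarrow> 'x topology" where
  "norm_topology E = Metric_space.mtopology (carrier E) (vdist E)"

definition dual :: "('k::real_normed_field, 'x) nvs \<Rightarrow> ('x \<Rightarrow> 'k) set" where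
  "dual E = {\<psi>.
     (\<forall>x\<in>carrier E. \<forall>y\<in>carrier E. \<psi> (x \<oplus>\<^bsub>E\<^esub> y) = \<psi> x + \<psi> y) \<and>
     (\<forall>x\<in>carrier E. \<forall>c. \<psi> (c \<odot>\<^bsub>E\<^esub> x) = c * \<psi> x) \<and>
     (\<exists>K. \<forall>x\<in>carrier E. norm (\<psi> x) \<le> K * vnorm E x)}"

definition weak_topology :: "('k::real_normed_field, 'x) nvs \<Rightarrow> 'x topology" where
  "weak_topology E =
     topology_generated_by {{x \<in> carrier E. \<psi> x \<in> U} | \<psi> U. \<psi> \<in> dual E \<and> open U}"

definition closed_span :: "('k::real_normed_field, 'x) nvs \<Rightarrow> 'x set \<Rightarrow> 'x set" where
  "closed_span E A =
     norm_topology E closure_of ((\<lambda>W. submodule W (scalars :: 'k ring) E) hull A)"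

section \<open>Bounded operators\<close>

text \<open>Operators are extensional functions on the carrier, so that equality of operators is
  equality of functions.\<close>

definition bounded_operators :: "('k, 'x) nvs \<Rightarrow> ('x \<Rightarrow> 'x) set" where
  "bounded_operators E = {T \<in> carrier E \<rightarrow>\<^sub>E carrier E.
     (\<forall>x\<in>carrier E. \<forall>y\<in>carrier E. T (x \<oplus>\<^bsub>E\<^esub> y) = T x \<oplus>\<^bsub>E\<^esub> T y) \<and>
     (\<forall>x\<in>carrier E. \<forall>c. T (c \<odot>\<^bsub>E\<^esub> x) = c \<odot>\<^bsub>E\<^esub> T x) \<and>
     (\<exists>K. \<forall>x\<in>carrier E. vnorm E (T x) \<le> K * vnorm E x)}"

text \<open>Norm of a linear map defined on the subspace \<open>V\<close> of \<open>E\<close>; it is \<open>\<infinity>\<close> if the map is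
  unbounded.\<close>

definition operator_norm_on :: "('k, 'x) nvs \<Rightarrow> 'x set \<Rightarrow> ('x \<Rightarrow> 'x) \<Rightarrow> ereal" where
  "operator_norm_on E V T = (SUP x\<in>{x \<in> V. vnorm E x \<le> 1}. ereal (vnorm E (T x)))"

text \<open>The strong and the weak operator topology are the topologies of pointwise convergence with
  respect to the norm and the weak topology of the space.\<close>

definition sot :: "('k, 'x) nvs \<Rightarrow> ('x \<Rightarrow> 'x) topology" where
  "sot E =
     subtopology (product_topology (\<lambda>_. norm_topology E) (carrier E)) (bounded_operators E)"

definition wot :: "('k::real_normed_field, 'x) nvs \<Rightarrow> ('x \<Rightarrow> 'x) topology" where
  "wot E =
     subtopology (product_topology (\<lambda>_. weak_topology E) (carrier E)) (bounded_operators E)"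

section \<open>Representations of a semigroup\<close>

definition operator_homomorphism ::
    "('k, 'x) nvs \<Rightarrow> ('s::semigroup_mult \<Rightarrow> 'x \<Rightarrow> 'x) \<Rightarrow> bool" where
  "operator_homomorphism E \<Phi> \<longleftrightarrow>
     (\<forall>s. \<Phi> s \<in> bounded_operators E) \<and>
     (\<forall>s t. \<Phi> (s * t) = compose (carrier E) (\<Phi> s) (\<Phi> t))"

definition sup_operator_norm :: "('k, 'x) nvs \<Rightarrow> ('s \<Rightarrow> 'x \<Rightarrow> 'x) \<Rightarrow> ereal" where
  "sup_operator_norm E \<Phi> = (SUP s. operator_norm_on E (carrier E) (\<Phi> s))"

definition null_part :: "('k, 'x) nvs \<Rightarrow> ('s \<Rightarrow> 'x \<Rightarrow> 'x) \<Rightarrow> 'x set" where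
  "null_part E \<Phi> = (\<Inter>s. {x \<in> carrier E. \<Phi> s x \<ominus>\<^bsub>E\<^esub> x = \<zero>\<^bsub>E\<^esub>})"

definition range_part ::
    "('k::real_normed_field, 'x) nvs \<Rightarrow> ('s \<Rightarrow> 'x \<Rightarrow> 'x) \<Rightarrow> 'x set" where
  "range_part E \<Phi> = closed_span E (\<Union>s. (\<lambda>x. \<Phi> s x \<ominus>\<^bsub>E\<^esub> x) ` carrier E)"

definition sum_part ::
    "('k::real_normed_field, 'x) nvs \<Rightarrow> ('s \<Rightarrow> 'x \<Rightarrow> 'x) \<Rightarrow> 'x set" where
  "sum_part E \<Phi> = null_part E \<Phi> <+>\<^bsub>E\<^esub> range_part E \<Phi>"

text \<open>Well defined on \<open>sum_part E \<Phi>\<close> when the two summands meet in 0 only.\<close>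

definition null_projection ::
    "('k::real_normed_field, 'x) nvs \<Rightarrow> ('s \<Rightarrow> 'x \<Rightarrow> 'x) \<Rightarrow> 'x \<Rightarrow> 'x" where
  "null_projection E \<Phi> x =
     (THE y. y \<in> null_part E \<Phi> \<and> (\<exists>z\<in>range_part E \<Phi>. x = y \<oplus>\<^bsub>E\<^esub> z))"

text \<open>
  The property of all Banach spaces over \<open>'k\<close> whose elements are taken from the type \<open>'x\<close>, with
  \<open>\<tau>\<close> being \<open>wot\<close> or \<open>sot\<close>.
\<close>

definition decomposition_property ::
    "(('k::real_normed_field, 'x) nvs \<Rightarrow> ('x \<Rightarrow> 'x) topology)
       \<Rightarrow> 'k itself \<Rightarrow> 'x itself \<Rightarrow> 's::{semigroup_mult, topological_space} itself \<Rightarrow> bool" where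
  "decomposition_property \<tau> TYPE('k) TYPE('x) TYPE('s) \<longleftrightarrow>
     (\<forall>(E :: ('k, 'x) nvs) (\<Phi> :: 's \<Rightarrow> 'x \<Rightarrow> 'x).
        banach_space E \<and> operator_homomorphism E \<Phi> \<and>
        continuous_map euclidean (\<tau> E) \<Phi> \<and> sup_operator_norm E \<Phi> < \<infinity> \<longrightarrow>
          null_part E \<Phi> \<inter> range_part E \<Phi> = {\<zero>\<^bsub>E\<^esub>} \<and>
          closedin (norm_topology E) (sum_part E \<Phi>) \<and>
          operator_norm_on E (sum_part E \<Phi>) (null_projection E \<Phi>) \<le> sup_operator_norm E \<Phi>)"

section \<open>Function spaces and right amenability\<close>

definition translate :: "('s::semigroup_mult \<Rightarrow> real) \<Rightarrow> 's \<Rightarrow> 's \<Rightarrow> real" where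
  "translate f s = (\<lambda>t. f (t * s))"

definition C_r :: "('s::{semigroup_mult, topological_space} \<Rightarrow> real) set" where
  "C_r = {f \<in> bcontfun. \<forall>s. continuous_on UNIV (translate f s)}"

definition C_r_space ::
    "(real, 's::{semigroup_mult, topological_space} \<Rightarrow> real) nvs" where
  "C_r_space =
     \<lparr>carrier = C_r, mult = (\<lambda>f g t. f t * g t), one = (\<lambda>_. 1),
      zero = (\<lambda>_. 0), add = (\<lambda>f g t. f t + g t), smult = (\<lambda>c f t. c * f t),
      vnorm = (\<lambda>f. SUP t. \<bar>f t\<bar>)\<rparr>"

definition C_norm :: "('s::{semigroup_mult, topological_space} \<Rightarrow> real) set" where
  "C_norm = {f \<in> C_r.
     continuous_map euclidean (norm_topology C_r_space) (\<lambda>s. translate f s) \<and>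
     (\<forall>t. continuous_map euclidean (norm_topology C_r_space) (\<lambda>s. translate f (s * t)))}"

definition C_weak :: "('s::{semigroup_mult, topological_space} \<Rightarrow> real) set" where
  "C_weak = {f \<in> C_r.
     continuous_map euclidean (weak_topology C_r_space) (\<lambda>s. translate f s) \<and>
     (\<forall>t. continuous_map euclidean (weak_topology C_r_space) (\<lambda>s. translate f (s * t)))}"

definition mean_on :: "('s \<Rightarrow> real) set \<Rightarrow> (('s \<Rightarrow> real) \<Rightarrow> real) \<Rightarrow> bool" where
  "mean_on F \<phi> \<longleftrightarrow>
     (\<forall>f\<in>F. \<forall>g\<in>F. \<phi> (\<lambda>t. f t + g t) = \<phi> f + \<phi> g) \<and>
     (\<forall>f\<in>F. \<forall>c. \<phi> (\<lambda>t. c * f t) = c * \<phi> f) \<and>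
     (\<forall>f\<in>F. (INF t. f t) \<le> \<phi> f \<and> \<phi> f \<le> (SUP t. f t))"

definition right_invariant_mean_on ::
    "('s::semigroup_mult \<Rightarrow> real) set \<Rightarrow> (('s \<Rightarrow> real) \<Rightarrow> real) \<Rightarrow> bool" where
  "right_invariant_mean_on F \<phi> \<longleftrightarrow>
     mean_on F \<phi> \<and> (\<forall>f\<in>F. \<forall>s. \<phi> (translate f s) = \<phi> f)"

definition weakly_right_amenable ::
    "'s::{semigroup_mult, topological_space} itself \<Rightarrow> bool" where
  "weakly_right_amenable TYPE('s) \<longleftrightarrow>
     (\<exists>\<phi>. right_invariant_mean_on (C_norm :: ('s \<Rightarrow> real) set) \<phi>)"

definition strongly_right_amenable ::
    "'s::{semigroup_mult, topological_space} itself \<Rightarrow> bool" where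
  "strongly_right_amenable TYPE('s) \<longleftrightarrow>
     (\<exists>\<phi>. right_invariant_mean_on (C_weak :: ('s \<Rightarrow> real) set) \<phi>)"

section \<open>The range of the quantifier over Banach spaces\<close>

text \<open>
  HOL formulas cannot quantify over types, so the elements of the Banach spaces are taken from the
  type below. The type variable \<open>'x\<close> is arbitrary: a Banach space on any type
  has an isometric copy in the left summand, for a suitable instance of \<open>'x\<close>. The right summand
  has room for the spaces of functions on the semigroup, without which \<open>decomposition_property\<close>
  could hold merely because \<open>'x\<close> is too small a type.
\<close>

type_synonym ('x, 's) universe = "'x + ('s \<Rightarrow> real)"

end

theory Submission
  imports Defs
begin

text \<open>
  A representation \<open>s \<mapsto> T\<^sub>s\<close> with all norms at most \<open>M\<close> and an invariant mean are linked by the orbit functions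
  \<open>f(s) = u (T\<^sub>s x)\<close>, where \<open>u\<close> is a bounded real-linear functional. Translating an orbit function
  moves its base point, \<open>f\<^sub>s\<close> being the orbit function of \<open>T\<^sub>s x\<close>, so that continuity of the
  representation makes orbit functions members of the space on which the mean lives
  (\<open>orbit_in_C_weak\<close>, \<open>orbit_in_C_norm\<close>).

  From a mean to the decomposition: let \<open>y\<close> be fixed by all \<open>T\<^sub>s\<close>, let \<open>z\<close> be a combination of
  displacements \<open>T\<^sub>s x - x\<close>, and let \<open>u\<close> be a functional of norm at most 1 with \<open>u y = \<parallel>y\<parallel>\<close>. The
  invariant mean of the orbit function of \<open>y\<close> is \<open>\<parallel>y\<parallel>\<close>, that of \<open>z\<close> is 0, and the orbit function of
  \<open>y + z\<close> is at most \<open>M \<parallel>y + z\<parallel>\<close> everywhere; hence \<open>\<parallel>y\<parallel> \<le> M \<parallel>y + z\<parallel>\<close>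
  (\<open>norm_null_le_of_invariant_mean\<close>). This one inequality extends to the closed span of the
  displacements and yields all three properties: the intersection is trivial, the projection has
  norm at most \<open>M\<close>, and a convergent sequence of sums has Cauchy, hence convergent, summands
  (\<open>decomposition_of_norm_estimate\<close>).

  From the decomposition to a mean: the space of functions in question is itself a Banach space, on
  which right translation is a representation by contractions. The constant function 1 is fixed, so
  the decomposition gives \<open>1 \<le> \<parallel>1 + z\<parallel>\<close> for every \<open>z\<close> in the span of the displacements, and this
  rules out \<open>sup z < 0\<close> (\<open>Sup_nonneg_of_decomposition\<close>). Therefore the sublinear functional \<open>sup\<close>
  dominates a linear functional that vanishes on the displacements, and this functional is an
  invariant mean (\<open>invariant_mean_of_decomposition\<close>). Right translation is continuous in the
  required topology because the function space is built to make it so; in the weak case this also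
  uses that functionals extend from the subspace to the whole of \<open>C_r\<close> (\<open>dual_extension\<close>).

  Three steps call for the Hahn-Banach theorem: the norming functional, the extension of functionals
  and the mean. All three are instances of the Mazur-Orlicz theorem \<open>mazur_orlicz\<close>.
\<close>

section \<open>Vector spaces on carrier sets\<close>

lemma scalars_simps [simp]:
  "carrier (scalars :: 'k::real_normed_field ring) = UNIV"
  "a \<oplus>\<^bsub>(scalars :: 'k ring)\<^esub> b = a + b"
  "a \<otimes>\<^bsub>(scalars :: 'k ring)\<^esub> b = a * b"
  "\<zero>\<^bsub>(scalars :: 'k ring)\<^esub> = 0"
  "\<one>\<^bsub>(scalars :: 'k ring)\<^esub> = 1"
  by (simp_all add: ring_of_type_algebra_def)

lemma cring_scalars: "cring (scalars :: 'k::real_normed_field ring)"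
  by (rule cring_from_type_algebra)

lemma scalars_uminus [simp]: "\<ominus>\<^bsub>(scalars :: 'k::real_normed_field ring)\<^esub> a = - a"
proof -
  interpret cring "scalars :: 'k ring" by (rule cring_scalars)
  show ?thesis by (rule minus_equality) auto
qed

locale vector_space_on = module "scalars :: 'k::real_normed_field ring" V
  for V :: "('k::real_normed_field, 'x, 'm) module_scheme" (structure)
begin

lemma scale_closed [simp]: "x \<in> carrier V \<Longrightarrow> c \<odot> x \<in> carrier V"
  using smult_closed by simp
lemma scale_add_left: "x \<in> carrier V \<Longrightarrow> (a + b) \<odot> x = a \<odot> x \<oplus>\<^bsub>V\<^esub> b \<odot> x"
  using smult_l_distr[of a b x] by simp
lemma scale_add_right:
  "x \<in> carrier V \<Longrightarrow> y \<in> carrier V \<Longrightarrow> a \<odot> (x \<oplus>\<^bsub>V\<^esub> y) = a \<odot> x \<oplus>\<^bsub>V\<^esub> a \<odot> y"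
  using smult_r_distr[of a x y] by simp
lemma scale_scale [simp]: "x \<in> carrier V \<Longrightarrow> a \<odot> (b \<odot> x) = (a * b) \<odot> x"
  using smult_assoc1[of a b x] by simp
lemma scale_one [simp]: "x \<in> carrier V \<Longrightarrow> 1 \<odot> x = x"
  using smult_one[of x] by simp
lemma scale_zero_left [simp]: "x \<in> carrier V \<Longrightarrow> 0 \<odot> x = \<zero>\<^bsub>V\<^esub>"
  using smult_l_null[of x] by simp
lemma scale_zero_right [simp]: "a \<odot> \<zero>\<^bsub>V\<^esub> = \<zero>\<^bsub>V\<^esub>"
  using smult_r_null[of a] by simp
lemma scale_minus_left: "x \<in> carrier V \<Longrightarrow> (- a) \<odot> x = \<ominus>\<^bsub>V\<^esub> (a \<odot> x)"
  using smult_l_minus[of a x] by simp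
lemma scale_minus_right: "x \<in> carrier V \<Longrightarrow> a \<odot> (\<ominus>\<^bsub>V\<^esub> x) = \<ominus>\<^bsub>V\<^esub> (a \<odot> x)"
  using smult_r_minus[of a x] by simp
lemma scale_minus_one: "x \<in> carrier V \<Longrightarrow> (- 1) \<odot> x = \<ominus>\<^bsub>V\<^esub> x"
  using scale_minus_left[of x 1] by simp
lemma scale_diff_right:
  "x \<in> carrier V \<Longrightarrow> y \<in> carrier V \<Longrightarrow> a \<odot> (x \<ominus>\<^bsub>V\<^esub> y) = a \<odot> x \<ominus>\<^bsub>V\<^esub> a \<odot> y"
  by (simp add: a_minus_def scale_add_right scale_minus_right)

end

section \<open>Sublinear functionals and the Mazur-Orlicz theorem\<close>

text \<open>
  Homogeneity is only asked as an inequality, which is what constructions by infima deliver; the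
  reverse inequality is the same one for the inverse scalar.
\<close>

definition sublinear_on :: "(real, 'x, 'm) module_scheme \<Rightarrow> ('x \<Rightarrow> real) \<Rightarrow> bool" where
  "sublinear_on V p \<longleftrightarrow>
     (\<forall>x\<in>carrier V. \<forall>y\<in>carrier V. p (x \<oplus>\<^bsub>V\<^esub> y) \<le> p x + p y) \<and>
     (\<forall>x\<in>carrier V. \<forall>c>0. p (c \<odot>\<^bsub>V\<^esub> x) \<le> c * p x)"

definition linear_on_carrier :: "(real, 'x, 'm) module_scheme \<Rightarrow> ('x \<Rightarrow> real) \<Rightarrow> bool" where
  "linear_on_carrier V u \<longleftrightarrow>
     (\<forall>x\<in>carrier V. \<forall>y\<in>carrier V. u (x \<oplus>\<^bsub>V\<^esub> y) = u x + u y) \<and>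
     (\<forall>x\<in>carrier V. \<forall>c. u (c \<odot>\<^bsub>V\<^esub> x) = c * u x)"

locale real_vector_space_on = vector_space_on V
  for V :: "(real, 'x, 'm) module_scheme" (structure)
begin

lemma sublinear_onD:
  assumes "sublinear_on V p"
  shows sublinear_add: "\<And>x y. x \<in> carrier V \<Longrightarrow> y \<in> carrier V \<Longrightarrow> p (x \<oplus>\<^bsub>V\<^esub> y) \<le> p x + p y"
    and sublinear_scale: "\<And>x c. x \<in> carrier V \<Longrightarrow> c > 0 \<Longrightarrow> p (c \<odot> x) = c * p x"
    and sublinear_zero: "p \<zero>\<^bsub>V\<^esub> = 0"
    and sublinear_minus: "\<And>x. x \<in> carrier V \<Longrightarrow> - p (\<ominus>\<^bsub>V\<^esub> x) \<le> p x"
proof -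
  show add: "p (x \<oplus>\<^bsub>V\<^esub> y) \<le> p x + p y" if "x \<in> carrier V" "y \<in> carrier V" for x y
    using assms that by (auto simp: sublinear_on_def)
  show "p (c \<odot> x) = c * p x" if "x \<in> carrier V" "c > 0" for x c
  proof (rule antisym)
    show "p (c \<odot> x) \<le> c * p x" using assms that by (auto simp: sublinear_on_def)
    have "p (inverse c \<odot> (c \<odot> x)) \<le> inverse c * p (c \<odot> x)"
      using assms that unfolding sublinear_on_def
      by (meson positive_imp_inverse_positive scale_closed)
    then show "c * p x \<le> p (c \<odot> x)" using that by (simp add: field_simps)
  qed
  from this[of "\<zero>\<^bsub>V\<^esub>" 2] show 0: "p \<zero>\<^bsub>V\<^esub> = 0" by simp
  show "- p (\<ominus>\<^bsub>V\<^esub> x) \<le> p x" if "x \<in> carrier V" for x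
    using add[of x "\<ominus>\<^bsub>V\<^esub> x"] that 0 by (simp add: M.r_neg)
qed

text \<open>
  The single construction behind everything in this section: lowering \<open>p\<close> along a convex cone \<open>G\<close> of
  pairs \<open>(w, a)\<close>, to the infimum of \<open>p (x + w) - a\<close>. The hypothesis \<open>a \<le> p w\<close> keeps the infimum
  above \<open>- p (- x)\<close>, and at \<open>x = - w\<close> the result is at most \<open>- a\<close>.
\<close>

lemma sublinear_minorant_along_cone:
  assumes p: "sublinear_on V p"
    and G: "G \<subseteq> carrier V \<times> UNIV" "(\<zero>\<^bsub>V\<^esub>, 0) \<in> G"
    and G_add: "\<And>w a w' a'. (w, a) \<in> G \<Longrightarrow> (w', a') \<in> G \<Longrightarrow> (w \<oplus>\<^bsub>V\<^esub> w', a + a') \<in> G"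
    and G_scale: "\<And>w a c. (w, a) \<in> G \<Longrightarrow> c > 0 \<Longrightarrow> (c \<odot> w, c * a) \<in> G"
    and G_le: "\<And>w a. (w, a) \<in> G \<Longrightarrow> a \<le> p w"
  obtains q where "sublinear_on V q" "\<And>x. x \<in> carrier V \<Longrightarrow> q x \<le> p x"
    "\<And>x w a. x \<in> carrier V \<Longrightarrow> (w, a) \<in> G \<Longrightarrow> q x \<le> p (x \<oplus>\<^bsub>V\<^esub> w) - a"
proof -
  define q where "q x = (INF g\<in>G. p (x \<oplus>\<^bsub>V\<^esub> fst g) - snd g)" for x
  have G': "fst g \<in> carrier V" if "g \<in> G" for g
    using G(1) that by auto
  have bdd: "bdd_below ((\<lambda>g. p (x \<oplus>\<^bsub>V\<^esub> fst g) - snd g) ` G)" if x: "x \<in> carrier V" for x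
  proof (rule bdd_belowI2)
    fix g assume g: "g \<in> G"
    have "fst g = (x \<oplus>\<^bsub>V\<^esub> fst g) \<oplus>\<^bsub>V\<^esub> \<ominus>\<^bsub>V\<^esub> x"
      using x G'[OF g] M.a_comm[of x "fst g"] by (simp add: M.a_assoc M.r_neg)
    then have "p (fst g) \<le> p (x \<oplus>\<^bsub>V\<^esub> fst g) + p (\<ominus>\<^bsub>V\<^esub> x)"
      using sublinear_add[OF p, of "x \<oplus>\<^bsub>V\<^esub> fst g" "\<ominus>\<^bsub>V\<^esub> x"] x G'[OF g] by simp
    moreover have "snd g \<le> p (fst g)" using G_le[of "fst g" "snd g"] g by simp
    ultimately show "- p (\<ominus>\<^bsub>V\<^esub> x) \<le> p (x \<oplus>\<^bsub>V\<^esub> fst g) - snd g" by linarith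
  qed
  have le: "q x \<le> p (x \<oplus>\<^bsub>V\<^esub> fst g) - snd g" if "x \<in> carrier V" "g \<in> G" for x g
    unfolding q_def using bdd[OF that(1)] that(2) by (rule cINF_lower)
  have ge: "b \<le> q x" if "\<And>g. g \<in> G \<Longrightarrow> b \<le> p (x \<oplus>\<^bsub>V\<^esub> fst g) - snd g" for b x
    unfolding q_def using G(2) that by (intro cINF_greatest) auto
  show thesis
  proof
    show "sublinear_on V q"
      unfolding sublinear_on_def
    proof safe
      fix x y assume xy: "x \<in> carrier V" "y \<in> carrier V"
      have *: "q (x \<oplus>\<^bsub>V\<^esub> y) \<le> (p (x \<oplus>\<^bsub>V\<^esub> fst g) - snd g) + (p (y \<oplus>\<^bsub>V\<^esub> fst h) - snd h)"
        if gh: "g \<in> G" "h \<in> G" for g h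
      proof -
        have gh': "(fst g \<oplus>\<^bsub>V\<^esub> fst h, snd g + snd h) \<in> G"
          using G_add[of "fst g" "snd g" "fst h" "snd h"] gh by simp
        have "(x \<oplus>\<^bsub>V\<^esub> y) \<oplus>\<^bsub>V\<^esub> (fst g \<oplus>\<^bsub>V\<^esub> fst h) = (x \<oplus>\<^bsub>V\<^esub> fst g) \<oplus>\<^bsub>V\<^esub> (y \<oplus>\<^bsub>V\<^esub> fst h)"
          using xy G' gh by (simp add: M.a_ac)
        then show ?thesis
          using le[of "x \<oplus>\<^bsub>V\<^esub> y", OF _ gh'] xy G' gh
            sublinear_add[OF p, of "x \<oplus>\<^bsub>V\<^esub> fst g" "y \<oplus>\<^bsub>V\<^esub> fst h"] by simp
      qed
      have "q (x \<oplus>\<^bsub>V\<^esub> y) - q y \<le> q x"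
      proof (rule ge)
        fix g assume g: "g \<in> G"
        have "q (x \<oplus>\<^bsub>V\<^esub> y) - (p (x \<oplus>\<^bsub>V\<^esub> fst g) - snd g) \<le> q y"
          using *[OF g] by (intro ge) (simp add: algebra_simps)
        then show "q (x \<oplus>\<^bsub>V\<^esub> y) - q y \<le> p (x \<oplus>\<^bsub>V\<^esub> fst g) - snd g" by simp
      qed
      then show "q (x \<oplus>\<^bsub>V\<^esub> y) \<le> q x + q y" by simp
    next
      fix x and c :: real assume x: "x \<in> carrier V" and c: "c > 0"
      have "q (c \<odot> x) / c \<le> q x"
      proof (rule ge)
        fix g assume g: "g \<in> G"
        have "(c \<odot> fst g, c * snd g) \<in> G" using G_scale[of "fst g" "snd g" c] g c by simp
        from le[OF _ this, of "c \<odot> x"]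
        have "q (c \<odot> x) \<le> p (c \<odot> (x \<oplus>\<^bsub>V\<^esub> fst g)) - c * snd g"
          using x G'[OF g] by (simp add: scale_add_right)
        also have "\<dots> = c * (p (x \<oplus>\<^bsub>V\<^esub> fst g) - snd g)"
          using x G'[OF g] c by (simp add: sublinear_scale[OF p] algebra_simps)
        finally show "q (c \<odot> x) / c \<le> p (x \<oplus>\<^bsub>V\<^esub> fst g) - snd g"
          using c by (simp add: pos_divide_le_eq mult.commute)
      qed
      then show "q (c \<odot> x) \<le> c * q x" using c by (simp add: pos_divide_le_eq mult.commute)
    qed
    show "q x \<le> p x" if "x \<in> carrier V" for x
      using le[OF that G(2)] that by simp
    show "q x \<le> p (x \<oplus>\<^bsub>V\<^esub> w) - a" if "x \<in> carrier V" "(w, a) \<in> G" for x w a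
      using le[OF that] by simp
  qed
qed

text \<open>
  Zorn's lemma, downwards: the pointwise infimum of a chain is bounded below by \<open>- p (- x)\<close>, and it is
  subadditive because any two members of the chain can be replaced by the smaller one. Functionals are
  made extensional to have a partial order.
\<close>

lemma exists_minimal_sublinear:
  assumes p: "sublinear_on V p"
  obtains q where "sublinear_on V q" "\<And>x. x \<in> carrier V \<Longrightarrow> q x \<le> p x"
    "\<And>r x. sublinear_on V r \<Longrightarrow> (\<And>x. x \<in> carrier V \<Longrightarrow> r x \<le> q x) \<Longrightarrow> x \<in> carrier V \<Longrightarrow> r x = q x"
proof -
  define A where "A = {q. sublinear_on V q \<and> (\<forall>x\<in>carrier V. q x \<le> p x) \<and> q \<in> extensional (carrier V)}"
  define P :: "('x \<Rightarrow> real) \<Rightarrow> ('x \<Rightarrow> real) \<Rightarrow> bool" where "P q r \<longleftrightarrow> (\<forall>x\<in>carrier V. r x \<le> q x)" for q r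
  have restrict: "restrict r (carrier V) \<in> A"
    if "sublinear_on V r" "\<And>x. x \<in> carrier V \<Longrightarrow> r x \<le> p x" for r
    using that by (auto simp: A_def sublinear_on_def)
  have "\<exists>m\<in>A. \<forall>a\<in>A. P m a \<longrightarrow> a = m"
  proof (rule predicate_Zorn)
    have "a = b" if "a \<in> A" "b \<in> A" "P a b" "P b a" for a b
    proof (rule extensionalityI[of _ "carrier V"])
      show "a x = b x" if "x \<in> carrier V" for x
        using \<open>P a b\<close> \<open>P b a\<close> that unfolding P_def by (meson order_antisym)
    qed (use that in \<open>simp_all add: A_def\<close>)
    then show "partial_order_on A (relation_of P A)"
      by (intro partial_order_on_relation_ofI) (auto simp: P_def intro: order_trans)
  next
    fix C assume C: "C \<in> Chains (relation_of P A)"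
    show "\<exists>u\<in>A. \<forall>a\<in>C. P a u"
    proof (cases "C = {}")
      case True
      then show ?thesis using restrict[OF p] by auto
    next
      case False
      have CA: "q \<in> A" if "q \<in> C" for q
        using C that by (auto simp: Chains_def relation_of_def)
      have chain: "P q r \<or> P r q" if "q \<in> C" "r \<in> C" for q r
        using C that by (auto simp: Chains_def relation_of_def)
      define i where "i x = (INF q\<in>C. q x)" for x
      have bdd: "bdd_below ((\<lambda>q. q x) ` C)" if x: "x \<in> carrier V" for x
      proof (rule bdd_belowI2)
        fix q assume "q \<in> C"
        then have "- q (\<ominus>\<^bsub>V\<^esub> x) \<le> q x" "q (\<ominus>\<^bsub>V\<^esub> x) \<le> p (\<ominus>\<^bsub>V\<^esub> x)"
          using CA[of q] x sublinear_minus[of q x] by (auto simp: A_def)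
        then show "- p (\<ominus>\<^bsub>V\<^esub> x) \<le> q x" by linarith
      qed
      have le: "i x \<le> q x" if "x \<in> carrier V" "q \<in> C" for x q
        unfolding i_def using bdd[OF that(1)] that(2) by (rule cINF_lower)
      have ge: "b \<le> i x" if "\<And>q. q \<in> C \<Longrightarrow> b \<le> q x" for b x
        unfolding i_def using False that by (rule cINF_greatest)
      have "sublinear_on V i"
        unfolding sublinear_on_def
      proof safe
        fix x y assume xy: "x \<in> carrier V" "y \<in> carrier V"
        have *: "i (x \<oplus>\<^bsub>V\<^esub> y) \<le> q x + r y" if qr: "q \<in> C" "r \<in> C" for q r
        proof -
          have sub: "s (x \<oplus>\<^bsub>V\<^esub> y) \<le> s x + s y" if "s \<in> C" for s
            using CA[OF that] xy by (auto simp: A_def sublinear_on_def)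
          show ?thesis
            using chain[OF qr] sub[OF qr(1)] sub[OF qr(2)] xy
              le[of "x \<oplus>\<^bsub>V\<^esub> y", OF _ qr(1)] le[of "x \<oplus>\<^bsub>V\<^esub> y", OF _ qr(2)]
            unfolding P_def by (smt (verit) M.a_closed)
        qed
        have "i (x \<oplus>\<^bsub>V\<^esub> y) - i y \<le> i x"
        proof (rule ge)
          fix q assume q: "q \<in> C"
          have "i (x \<oplus>\<^bsub>V\<^esub> y) - q x \<le> i y" using *[OF q] by (intro ge) (simp add: algebra_simps)
          then show "i (x \<oplus>\<^bsub>V\<^esub> y) - i y \<le> q x" by simp
        qed
        then show "i (x \<oplus>\<^bsub>V\<^esub> y) \<le> i x + i y" by simp
      next
        fix x and c :: real assume x: "x \<in> carrier V" and c: "c > 0"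
        have "i (c \<odot> x) / c \<le> i x"
        proof (rule ge)
          fix q assume q: "q \<in> C"
          then have "q (c \<odot> x) \<le> c * q x" using CA[OF q] x c by (auto simp: A_def sublinear_on_def)
          then have "i (c \<odot> x) \<le> c * q x" using le[of "c \<odot> x", OF _ q] x by simp
          then show "i (c \<odot> x) / c \<le> q x" using c by (simp add: pos_divide_le_eq mult.commute)
        qed
        then show "i (c \<odot> x) \<le> c * i x" using c by (simp add: pos_divide_le_eq mult.commute)
      qed
      moreover have "i x \<le> p x" if "x \<in> carrier V" for x
      proof -
        obtain q where q: "q \<in> C" using False by auto
        then have "q x \<le> p x" using CA that by (auto simp: A_def)
        then show ?thesis using le[OF that q] by simp
      qed
      ultimately have "restrict i (carrier V) \<in> A" by (rule restrict)
      moreover have "P q (restrict i (carrier V))" if "q \<in> C" for q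
        using le that by (auto simp: P_def)
      ultimately show ?thesis by blast
    qed
  qed
  then obtain m where m: "m \<in> A" and min: "\<And>a. a \<in> A \<Longrightarrow> P m a \<Longrightarrow> a = m" by blast
  show thesis
  proof
    show "sublinear_on V m" "\<And>x. x \<in> carrier V \<Longrightarrow> m x \<le> p x" using m by (auto simp: A_def)
    fix r x assume r: "sublinear_on V r" "\<And>x. x \<in> carrier V \<Longrightarrow> r x \<le> m x" and x: "x \<in> carrier V"
    have "restrict r (carrier V) \<in> A"
      using r m by (intro restrict) (auto simp: A_def intro: order_trans)
    then have "restrict r (carrier V) = m" using r(2) by (intro min) (auto simp: P_def)
    then show "r x = m x" using x by (metis restrict_apply')
  qed
qed

text \<open>
  Lowering \<open>q\<close> along the ray through \<open>(y, q y)\<close> cannot change a minimal \<open>q\<close>; this says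
  \<open>q x \<le> q (x + y) - q y\<close>, the missing half of additivity.
\<close>

lemma minimal_sublinear_is_linear:
  assumes q: "sublinear_on V q"
    and min: "\<And>r x. sublinear_on V r \<Longrightarrow> (\<And>x. x \<in> carrier V \<Longrightarrow> r x \<le> q x) \<Longrightarrow> x \<in> carrier V \<Longrightarrow> r x = q x"
  shows "linear_on_carrier V q"
proof -
  have add: "q (x \<oplus>\<^bsub>V\<^esub> y) = q x + q y" if x: "x \<in> carrier V" and y: "y \<in> carrier V" for x y
  proof (rule antisym)
    show "q (x \<oplus>\<^bsub>V\<^esub> y) \<le> q x + q y" using sublinear_add[OF q x y] .
    define G where "G = {(t \<odot> y, t * q y) | t. t \<ge> 0}"
    obtain r where r: "sublinear_on V r" "\<And>x. x \<in> carrier V \<Longrightarrow> r x \<le> q x"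
      "\<And>x w a. x \<in> carrier V \<Longrightarrow> (w, a) \<in> G \<Longrightarrow> r x \<le> q (x \<oplus>\<^bsub>V\<^esub> w) - a"
    proof (rule sublinear_minorant_along_cone[OF q, of G])
      show "G \<subseteq> carrier V \<times> UNIV" using y by (auto simp: G_def)
      show "(\<zero>\<^bsub>V\<^esub>, 0) \<in> G" using y by (force simp: G_def)
      show "(w \<oplus>\<^bsub>V\<^esub> w', a + a') \<in> G" if "(w, a) \<in> G" "(w', a') \<in> G" for w a w' a'
      proof -
        from that obtain t t' where "w = t \<odot> y" "a = t * q y" "t \<ge> 0" "w' = t' \<odot> y" "a' = t' * q y" "t' \<ge> 0"
          by (auto simp: G_def)
        then show ?thesis
          unfolding G_def using y by (auto intro!: exI[of _ "t + t'"] simp: scale_add_left distrib_right)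
      qed
      show "(c \<odot> w, c * a) \<in> G" if "(w, a) \<in> G" "c > 0" for w a c
      proof -
        from that obtain t where "w = t \<odot> y" "a = t * q y" "t \<ge> 0" by (auto simp: G_def)
        then show ?thesis
          unfolding G_def using y that by (auto intro!: exI[of _ "c * t"])
      qed
      show "a \<le> q w" if "(w, a) \<in> G" for w a
      proof -
        from that obtain t where t: "w = t \<odot> y" "a = t * q y" "t \<ge> 0" by (auto simp: G_def)
        then show ?thesis
          using sublinear_scale[OF q y, of t] sublinear_zero[OF q] y by (cases "t = 0") auto
      qed
    qed blast
    have "(y, q y) \<in> G" using y by (auto simp: G_def intro!: exI[of _ 1])
    then have "r x \<le> q (x \<oplus>\<^bsub>V\<^esub> y) - q y" using r(3) x by blast
    moreover have "r x = q x" using min[OF r(1,2) x] by blast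
    ultimately show "q x + q y \<le> q (x \<oplus>\<^bsub>V\<^esub> y)" by simp
  qed
  have neg: "q (\<ominus>\<^bsub>V\<^esub> x) = - q x" if "x \<in> carrier V" for x
    using add[of x "\<ominus>\<^bsub>V\<^esub> x"] that sublinear_zero[OF q] by (simp add: M.r_neg)
  have "q (c \<odot> x) = c * q x" if x: "x \<in> carrier V" for x c
  proof -
    consider "c > 0" | "c = 0" | "c < 0" by linarith
    then show ?thesis
    proof cases
      case 3
      then have "q ((- c) \<odot> x) = - c * q x" by (intro sublinear_scale[OF q x]) simp
      then show ?thesis using x neg[of "c \<odot> x"] by (simp add: scale_minus_left)
    qed (use x sublinear_scale[OF q x] sublinear_zero[OF q] in auto)
  qed
  with add show ?thesis by (auto simp: linear_on_carrier_def)
qed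

text \<open>
  A convex cone in place of the usual subspace makes norming functionals, extensions of functionals
  and invariant means direct instances. A minimal sublinear functional below the one lowered
  along \<open>G\<close> is linear, and its value at \<open>- w\<close> is at most \<open>- a\<close>.
\<close>

theorem mazur_orlicz:
  assumes p: "sublinear_on V p"
    and G: "G \<subseteq> carrier V \<times> UNIV" "(\<zero>\<^bsub>V\<^esub>, 0) \<in> G"
    and G_add: "\<And>w a w' a'. (w, a) \<in> G \<Longrightarrow> (w', a') \<in> G \<Longrightarrow> (w \<oplus>\<^bsub>V\<^esub> w', a + a') \<in> G"
    and G_scale: "\<And>w a c. (w, a) \<in> G \<Longrightarrow> c > 0 \<Longrightarrow> (c \<odot> w, c * a) \<in> G"
    and G_le: "\<And>w a. (w, a) \<in> G \<Longrightarrow> a \<le> p w"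
  obtains u where "linear_on_carrier V u" "\<And>x. x \<in> carrier V \<Longrightarrow> u x \<le> p x"
    "\<And>w a. (w, a) \<in> G \<Longrightarrow> a \<le> u w"
proof -
  obtain r where r: "sublinear_on V r" "\<And>x. x \<in> carrier V \<Longrightarrow> r x \<le> p x"
    "\<And>x w a. x \<in> carrier V \<Longrightarrow> (w, a) \<in> G \<Longrightarrow> r x \<le> p (x \<oplus>\<^bsub>V\<^esub> w) - a"
    using sublinear_minorant_along_cone[OF assms] by blast
  obtain u where u: "sublinear_on V u" "\<And>x. x \<in> carrier V \<Longrightarrow> u x \<le> r x"
    "\<And>q x. sublinear_on V q \<Longrightarrow> (\<And>x. x \<in> carrier V \<Longrightarrow> q x \<le> u x) \<Longrightarrow> x \<in> carrier V \<Longrightarrow> q x = u x"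
    using exists_minimal_sublinear[OF r(1)] by blast
  show thesis
  proof
    show "linear_on_carrier V u" using u(1,3) by (rule minimal_sublinear_is_linear)
    show "u x \<le> p x" if "x \<in> carrier V" for x
      using u(2) r(2) that by (meson order_trans)
    fix w a assume wa: "(w, a) \<in> G"
    then have w: "w \<in> carrier V" using G(1) by auto
    have "u (\<ominus>\<^bsub>V\<^esub> w) \<le> p (\<ominus>\<^bsub>V\<^esub> w \<oplus>\<^bsub>V\<^esub> w) - a"
      using u(2)[of "\<ominus>\<^bsub>V\<^esub> w"] r(3)[of "\<ominus>\<^bsub>V\<^esub> w", OF _ wa] w by simp
    then show "a \<le> u w"
      using sublinear_minus[OF u(1) w] sublinear_zero[OF p] w by (simp add: M.l_neg)
  qed
qed

end

section \<open>Normed spaces and closed spans\<close>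

locale normed_carrier =
  fixes E :: "('k::real_normed_field, 'x) nvs" (structure)
  assumes normed: "normed_space E"

sublocale normed_carrier \<subseteq> vector_space_on E
  using normed by (simp add: normed_space_def vector_space_on_def)

context normed_carrier
begin

lemma norm_nonneg: "x \<in> carrier E \<Longrightarrow> 0 \<le> vnorm E x"
  using normed by (simp add: normed_space_def)
lemma norm_eq_zero: "x \<in> carrier E \<Longrightarrow> vnorm E x = 0 \<longleftrightarrow> x = \<zero>\<^bsub>E\<^esub>"
  using normed by (simp add: normed_space_def)
lemma norm_scale: "x \<in> carrier E \<Longrightarrow> vnorm E (c \<odot> x) = norm c * vnorm E x"
  using normed by (simp add: normed_space_def)
lemma norm_triangle:
  "x \<in> carrier E \<Longrightarrow> y \<in> carrier E \<Longrightarrow> vnorm E (x \<oplus>\<^bsub>E\<^esub> y) \<le> vnorm E x + vnorm E y"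
  using normed by (simp add: normed_space_def)
lemma norm_zero: "vnorm E \<zero>\<^bsub>E\<^esub> = 0"
  using norm_eq_zero[of "\<zero>\<^bsub>E\<^esub>"] by simp
lemma norm_minus: "x \<in> carrier E \<Longrightarrow> vnorm E (\<ominus>\<^bsub>E\<^esub> x) = vnorm E x"
  using norm_scale[of x "- 1"] by (simp add: scale_minus_one)

lemma diff_closed: "x \<in> carrier E \<Longrightarrow> y \<in> carrier E \<Longrightarrow> x \<ominus>\<^bsub>E\<^esub> y \<in> carrier E"
  by simp
lemma diff_eq_zero: "x \<in> carrier E \<Longrightarrow> y \<in> carrier E \<Longrightarrow> x \<ominus>\<^bsub>E\<^esub> y = \<zero>\<^bsub>E\<^esub> \<longleftrightarrow> x = y"
  by (metis M.add.inv_closed M.minus_eq M.minus_equality M.minus_minus M.r_neg)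
lemma minus_diff: "x \<in> carrier E \<Longrightarrow> y \<in> carrier E \<Longrightarrow> \<ominus>\<^bsub>E\<^esub> (x \<ominus>\<^bsub>E\<^esub> y) = y \<ominus>\<^bsub>E\<^esub> x"
  by (simp add: M.minus_eq M.minus_add M.a_comm)
lemma diff_telescope:
  assumes "x \<in> carrier E" "y \<in> carrier E" "z \<in> carrier E"
  shows "x \<ominus>\<^bsub>E\<^esub> z = (x \<ominus>\<^bsub>E\<^esub> y) \<oplus>\<^bsub>E\<^esub> (y \<ominus>\<^bsub>E\<^esub> z)"
proof -
  have "(x \<ominus>\<^bsub>E\<^esub> y) \<oplus>\<^bsub>E\<^esub> (y \<ominus>\<^bsub>E\<^esub> z) = x \<oplus>\<^bsub>E\<^esub> (\<ominus>\<^bsub>E\<^esub> y \<oplus>\<^bsub>E\<^esub> (y \<oplus>\<^bsub>E\<^esub> \<ominus>\<^bsub>E\<^esub> z))"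
    using assms by (simp add: M.minus_eq M.a_assoc)
  also have "\<dots> = x \<ominus>\<^bsub>E\<^esub> z" using assms by (simp add: M.minus_eq M.r_neg1)
  finally show ?thesis by simp
qed
lemma diff_add_add:
  assumes "x \<in> carrier E" "y \<in> carrier E" "x' \<in> carrier E" "y' \<in> carrier E"
  shows "(x \<oplus>\<^bsub>E\<^esub> y) \<ominus>\<^bsub>E\<^esub> (x' \<oplus>\<^bsub>E\<^esub> y') = (x \<ominus>\<^bsub>E\<^esub> x') \<oplus>\<^bsub>E\<^esub> (y \<ominus>\<^bsub>E\<^esub> y')"
  using assms by (simp add: M.minus_eq M.minus_add M.a_ac)
lemma add_diff_cancel_left:
  assumes "x \<in> carrier E" "y \<in> carrier E"
  shows "(x \<oplus>\<^bsub>E\<^esub> y) \<ominus>\<^bsub>E\<^esub> x = y"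
  using assms M.a_comm[of x y] by (simp add: M.minus_eq M.a_assoc M.r_neg)
lemma add_diff_cancel:
  assumes "x \<in> carrier E" "y \<in> carrier E"
  shows "x \<oplus>\<^bsub>E\<^esub> (y \<ominus>\<^bsub>E\<^esub> x) = y"
  using assms M.a_comm[of y "\<ominus>\<^bsub>E\<^esub> x"] by (simp add: M.minus_eq M.r_neg2)

lemma norm_diff_commute:
  "x \<in> carrier E \<Longrightarrow> y \<in> carrier E \<Longrightarrow> vnorm E (x \<ominus>\<^bsub>E\<^esub> y) = vnorm E (y \<ominus>\<^bsub>E\<^esub> x)"
  using norm_minus[of "x \<ominus>\<^bsub>E\<^esub> y"] by (simp add: minus_diff)

end

sublocale normed_carrier \<subseteq> metric: Metric_space "carrier E" "vdist E"
proof
  show "0 \<le> vdist E x y" for x y by (simp add: vdist_def norm_nonneg)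
  show "vdist E x y = vdist E y x" for x y by (auto simp: vdist_def norm_diff_commute)
  show "vdist E x y = 0 \<longleftrightarrow> x = y" if "x \<in> carrier E" "y \<in> carrier E" for x y
    using that by (simp add: vdist_def norm_eq_zero diff_eq_zero)
  show "vdist E x z \<le> vdist E x y + vdist E y z"
    if "x \<in> carrier E" "y \<in> carrier E" "z \<in> carrier E" for x y z
    using that norm_triangle[of "x \<ominus>\<^bsub>E\<^esub> y" "y \<ominus>\<^bsub>E\<^esub> z"] diff_telescope[of x y z] by (simp add: vdist_def)
qed

context normed_carrier
begin

lemma vdist_eq: "x \<in> carrier E \<Longrightarrow> y \<in> carrier E \<Longrightarrow> vdist E x y = vnorm E (x \<ominus>\<^bsub>E\<^esub> y)"
  by (simp add: vdist_def)

lemma norm_topology_eq: "norm_topology E = metric.mtopology"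
  by (simp add: norm_topology_def)

lemma continuous_map_norm_topology_iff:
  "continuous_map euclidean (norm_topology E) g \<longleftrightarrow>
     (\<forall>s. g s \<in> carrier E) \<and> (\<forall>s. \<forall>\<epsilon>>0. \<exists>U. open U \<and> s \<in> U \<and> (\<forall>t\<in>U. vnorm E (g t \<ominus>\<^bsub>E\<^esub> g s) < \<epsilon>))"
  (is "?L \<longleftrightarrow> ?R")
proof
  assume L: ?L
  then have car: "g s \<in> carrier E" for s
    using continuous_map_image_subset_topspace[of euclidean "norm_topology E" g] by (auto simp: norm_topology_eq)
  have "\<exists>U. open U \<and> s \<in> U \<and> (\<forall>t\<in>U. vnorm E (g t \<ominus>\<^bsub>E\<^esub> g s) < \<epsilon>)" if \<epsilon>: "\<epsilon> > 0" for s \<epsilon>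
  proof -
    obtain U where "open U" "s \<in> U" "\<forall>t\<in>U. g t \<in> metric.mball (g s) \<epsilon>"
      using L[unfolded norm_topology_eq metric.continuous_map_to_metric, rule_format, of s \<epsilon>] \<epsilon> by auto
    then show ?thesis using car by (auto simp: vdist_eq norm_diff_commute intro!: exI[of _ U])
  qed
  with car show ?R by blast
next
  assume R: ?R
  show ?L
    unfolding norm_topology_eq metric.continuous_map_to_metric
  proof (intro ballI allI impI)
    fix s and \<epsilon> :: real assume "\<epsilon> > 0"
    with R obtain U where "open U" "s \<in> U" "\<forall>t\<in>U. vnorm E (g t \<ominus>\<^bsub>E\<^esub> g s) < \<epsilon>" by blast
    then show "\<exists>U. openin euclidean U \<and> s \<in> U \<and> (\<forall>y\<in>U. g y \<in> metric.mball (g s) \<epsilon>)"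
      using R by (auto simp: vdist_eq norm_diff_commute intro!: exI[of _ U])
  qed
qed

lemma limit_norm_topology_iff:
  "limitin (norm_topology E) f x sequentially \<longleftrightarrow>
     x \<in> carrier E \<and> (\<forall>\<epsilon>>0. \<exists>N. \<forall>n\<ge>N. f n \<in> carrier E \<and> vnorm E (f n \<ominus>\<^bsub>E\<^esub> x) < \<epsilon>)"
  unfolding norm_topology_eq metric.limit_metric_sequentially
  by (simp add: vdist_def cong: conj_cong)

lemma submodule_zero: "submodule W scalars E \<Longrightarrow> \<zero>\<^bsub>E\<^esub> \<in> W"
  using subgroup.one_closed[OF submodule.axioms(1)] by fastforce

lemma submodule_hull:
  assumes "A \<subseteq> carrier E"
  shows "submodule ((\<lambda>W. submodule W scalars E) hull A) scalars E"
proof (rule submoduleI)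
  let ?H = "(\<lambda>W. submodule W scalars E) hull A"
  show "?H \<subseteq> carrier E" by (intro hull_minimal assms carrier_is_submodule)
  show "\<zero>\<^bsub>E\<^esub> \<in> ?H"
    using submodule_zero by (auto simp: hull_def)
  show "\<ominus>\<^bsub>E\<^esub> a \<in> ?H" if "a \<in> ?H" for a
    using that submoduleE(3) by (auto simp: hull_def)
  show "a \<oplus>\<^bsub>E\<^esub> b \<in> ?H" if "a \<in> ?H" "b \<in> ?H" for a b
    using that submoduleE(5) by (auto simp: hull_def)
  show "c \<odot> x \<in> ?H" if "x \<in> ?H" for c x
    using that submoduleE(4) by (auto simp: hull_def)
qed

lemma in_closed_span_iff:
  "z \<in> closed_span E A \<longleftrightarrow> z \<in> carrier E \<and>
     (\<forall>\<epsilon>>0. \<exists>w \<in> (\<lambda>W. submodule W scalars E) hull A. w \<in> carrier E \<and> vnorm E (z \<ominus>\<^bsub>E\<^esub> w) < \<epsilon>)"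
  unfolding closed_span_def norm_topology_eq metric.metric_closure_of
  by (auto simp: vdist_def)

lemma closedin_closed_span: "closedin (norm_topology E) (closed_span E A)"
  by (simp add: closed_span_def)

lemma hull_subset_closed_span:
  assumes "A \<subseteq> carrier E"
  shows "(\<lambda>W. submodule W scalars E) hull A \<subseteq> closed_span E A"
  using submoduleE(1)[OF submodule_hull[OF assms]]
  by (auto simp: closed_span_def norm_topology_eq intro!: closure_of_subset[THEN subsetD])

lemma submodule_closed_span:
  assumes A: "A \<subseteq> carrier E"
  shows "submodule (closed_span E A) scalars E"
proof (rule submoduleI)
  let ?H = "(\<lambda>W. submodule W scalars E) hull A"
  note H = submoduleE[OF submodule_hull[OF A]]
  have app: "\<exists>w\<in>?H. w \<in> carrier E \<and> vnorm E (z \<ominus>\<^bsub>E\<^esub> w) < \<epsilon>" if "z \<in> closed_span E A" "\<epsilon> > 0" for z \<epsilon>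
    using that by (simp add: in_closed_span_iff)
  show sub: "closed_span E A \<subseteq> carrier E" by (auto simp: in_closed_span_iff)
  show "\<zero>\<^bsub>E\<^esub> \<in> closed_span E A"
    using submodule_zero[OF submodule_hull[OF A]] hull_subset_closed_span[OF A] by auto
  show scale: "c \<odot> x \<in> closed_span E A" if x: "x \<in> closed_span E A" for c x
    unfolding in_closed_span_iff
  proof (intro conjI allI impI)
    show "c \<odot> x \<in> carrier E" using sub x by auto
    fix \<epsilon> :: real assume \<epsilon>: "\<epsilon> > 0"
    obtain w where w: "w \<in> ?H" "w \<in> carrier E" "vnorm E (x \<ominus>\<^bsub>E\<^esub> w) < \<epsilon> / (norm c + 1)"
      using app[OF x, of "\<epsilon> / (norm c + 1)"] \<epsilon> by (auto simp: add_nonneg_pos)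
    have "vnorm E (c \<odot> x \<ominus>\<^bsub>E\<^esub> c \<odot> w) = norm c * vnorm E (x \<ominus>\<^bsub>E\<^esub> w)"
      using x sub w(2) by (simp add: norm_scale subset_iff flip: scale_diff_right)
    also have "\<dots> \<le> (norm c + 1) * vnorm E (x \<ominus>\<^bsub>E\<^esub> w)"
      using x sub w(2) by (intro mult_right_mono norm_nonneg) auto
    also have "\<dots> < \<epsilon>" using w(3) by (simp add: pos_less_divide_eq add_nonneg_pos mult.commute)
    finally show "\<exists>w\<in>?H. w \<in> carrier E \<and> vnorm E (c \<odot> x \<ominus>\<^bsub>E\<^esub> w) < \<epsilon>"
      using w H(4) by (intro bexI[of _ "c \<odot> w"]) auto
  qed
  show "\<ominus>\<^bsub>E\<^esub> x \<in> closed_span E A" if "x \<in> closed_span E A" for x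
    using scale[OF that, of "- 1"] that sub by (auto simp: scale_minus_one)
  show "x \<oplus>\<^bsub>E\<^esub> y \<in> closed_span E A" if x: "x \<in> closed_span E A" and y: "y \<in> closed_span E A" for x y
    unfolding in_closed_span_iff
  proof (intro conjI allI impI)
    show "x \<oplus>\<^bsub>E\<^esub> y \<in> carrier E" using sub x y by auto
    fix \<epsilon> :: real assume \<epsilon>: "\<epsilon> > 0"
    obtain w where w: "w \<in> ?H" "w \<in> carrier E" "vnorm E (x \<ominus>\<^bsub>E\<^esub> w) < \<epsilon> / 2" using app[OF x, of "\<epsilon>/2"] \<epsilon> by auto
    obtain v where v: "v \<in> ?H" "v \<in> carrier E" "vnorm E (y \<ominus>\<^bsub>E\<^esub> v) < \<epsilon> / 2" using app[OF y, of "\<epsilon>/2"] \<epsilon> by auto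
    have "vnorm E ((x \<oplus>\<^bsub>E\<^esub> y) \<ominus>\<^bsub>E\<^esub> (w \<oplus>\<^bsub>E\<^esub> v)) < \<epsilon>"
      using norm_triangle[of "x \<ominus>\<^bsub>E\<^esub> w" "y \<ominus>\<^bsub>E\<^esub> v"] w v x y sub by (auto simp: diff_add_add subset_iff)
    then show "\<exists>w\<in>?H. w \<in> carrier E \<and> vnorm E (x \<oplus>\<^bsub>E\<^esub> y \<ominus>\<^bsub>E\<^esub> w) < \<epsilon>"
      using w v H(5) by (intro bexI[of _ "w \<oplus>\<^bsub>E\<^esub> v"]) auto
  qed
qed

end

section \<open>Real functionals\<close>

text \<open>
  The restriction of scalars. The proof only needs real functionals, also on a complex space, and
  this lets the real Mazur-Orlicz theorem apply to both cases at once. The components \<open>mult\<close> and \<open>one\<close>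
  are copied so that a real space is equal to its restriction.
\<close>

definition underlying_real :: "('k::real_normed_field, 'x) nvs \<Rightarrow> (real, 'x) nvs" where
  "underlying_real E =
     \<lparr>carrier = carrier E, mult = mult E, one = one E, zero = zero E, add = add E,
      smult = (\<lambda>c x. of_real c \<odot>\<^bsub>E\<^esub> x), vnorm = vnorm E\<rparr>"

lemma underlying_real_simps [simp]:
  "carrier (underlying_real E) = carrier E"
  "x \<oplus>\<^bsub>underlying_real E\<^esub> y = x \<oplus>\<^bsub>E\<^esub> y"
  "\<zero>\<^bsub>underlying_real E\<^esub> = \<zero>\<^bsub>E\<^esub>"
  "c \<odot>\<^bsub>underlying_real E\<^esub> x = of_real c \<odot>\<^bsub>E\<^esub> x"
  "vnorm (underlying_real E) = vnorm E"
  by (simp_all add: underlying_real_def)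

lemma underlying_real_real [simp]: "underlying_real (E :: (real, 'x) nvs) = E"
  by (cases E) (simp add: underlying_real_def)

lemma (in normed_carrier) real_vector_space_on_underlying_real:
  "real_vector_space_on (underlying_real E)"
proof -
  have "abelian_group (underlying_real E)"
  proof (rule abelian_groupI)
    fix x assume "x \<in> carrier (underlying_real E)"
    then show "\<exists>y\<in>carrier (underlying_real E). y \<oplus>\<^bsub>underlying_real E\<^esub> x = \<zero>\<^bsub>underlying_real E\<^esub>"
      by (intro bexI[of _ "\<ominus>\<^bsub>E\<^esub> x"]) (auto simp: M.l_neg)
  qed (auto simp: M.a_ac)
  then have "module (scalars :: real ring) (underlying_real E)"
    by (intro moduleI cring_scalars) (simp_all add: scale_add_left scale_add_right)
  then show ?thesis by (simp add: real_vector_space_on_def vector_space_on_def)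
qed

lemma (in normed_carrier) normed_space_underlying_real: "normed_space (underlying_real E)"
proof -
  interpret R: real_vector_space_on "underlying_real E" by (rule real_vector_space_on_underlying_real)
  show ?thesis
    using R.module_axioms by (simp add: normed_space_def norm_nonneg norm_eq_zero norm_scale norm_triangle)
qed

lemma (in normed_carrier) dual_bounded:
  assumes "u \<in> dual E"
  obtains K where "K \<ge> 0" "\<And>x. x \<in> carrier E \<Longrightarrow> norm (u x) \<le> K * vnorm E x"
proof -
  from assms obtain K where K: "\<forall>x\<in>carrier E. norm (u x) \<le> K * vnorm E x"
    unfolding dual_def by blast
  show thesis
  proof (rule that[of "\<bar>K\<bar>"])
    show "norm (u x) \<le> \<bar>K\<bar> * vnorm E x" if "x \<in> carrier E" for x
      using K that by (meson abs_ge_self mult_right_mono norm_nonneg order_trans)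
  qed simp
qed

lemma (in normed_carrier) dual_diff:
  assumes u: "u \<in> dual E" and xy: "x \<in> carrier E" "y \<in> carrier E"
  shows "u (x \<ominus>\<^bsub>E\<^esub> y) = u x - u y"
proof -
  have add: "u (x \<oplus>\<^bsub>E\<^esub> (- 1) \<odot> y) = u x + u ((- 1) \<odot> y)"
    using u xy scale_closed unfolding dual_def by blast
  have scale: "u ((- 1) \<odot> y) = (- 1) * u y"
    using u xy unfolding dual_def by blast
  show ?thesis using add scale xy by (simp add: M.minus_eq scale_minus_one)
qed

lemma dual_continuous_weak_topology:
  assumes "\<psi> \<in> dual E"
  shows "continuous_map (weak_topology E) euclidean \<psi>"
proof -
  have top: "topspace (weak_topology E) \<subseteq> carrier E"
    by (auto simp: weak_topology_def topology_generated_by_topspace)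
  have "openin (weak_topology E) {x \<in> topspace (weak_topology E). \<psi> x \<in> U}" if "open U" for U
  proof -
    have op: "openin (weak_topology E) {x \<in> carrier E. \<psi> x \<in> U}"
      unfolding weak_topology_def using assms that by (intro topology_generated_by_Basis) blast
    then have "{x \<in> carrier E. \<psi> x \<in> U} = {x \<in> topspace (weak_topology E). \<psi> x \<in> U}"
      using openin_subset[OF op] top by auto
    then show ?thesis using op by simp
  qed
  then show ?thesis by (simp add: continuous_map_def)
qed

lemma continuous_map_weak_topology_iff:
  fixes E :: "('k::real_normed_field, 'x) nvs"
  shows "continuous_map euclidean (weak_topology E) g \<longleftrightarrow>
     (\<forall>s. g s \<in> carrier E) \<and> (\<forall>\<psi>\<in>dual E. continuous_on UNIV (\<lambda>s. \<psi> (g s)))"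
  (is "?L \<longleftrightarrow> ?R")
proof
  assume L: ?L
  have "g s \<in> carrier E" for s
    using continuous_map_image_subset_topspace[OF L]
    by (auto simp: weak_topology_def topology_generated_by_topspace)
  moreover have "continuous_on UNIV (\<lambda>s. \<psi> (g s))" if "\<psi> \<in> dual E" for \<psi>
    using continuous_map_compose[OF L dual_continuous_weak_topology[OF that]] by (simp add: o_def)
  ultimately show ?R by blast
next
  assume R: ?R
  have z: "(\<lambda>_. 0) \<in> dual E" by (auto simp: dual_def intro!: exI[of _ 0])
  show ?L
    unfolding weak_topology_def continuous_on_generated_topo_iff
  proof safe
    fix \<psi> and U :: "'k set" assume "\<psi> \<in> dual E" "open U"
    then have "open ((\<lambda>s. \<psi> (g s)) -` U)" using R by (simp add: open_vimage continuous_on_eq_continuous_at)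
    moreover have "g -` {x \<in> carrier E. \<psi> x \<in> U} = (\<lambda>s. \<psi> (g s)) -` U" using R by auto
    ultimately show "openin euclidean (g -` {x \<in> carrier E. \<psi> x \<in> U} \<inter> topspace euclidean)" by simp
  next
    fix s
    have "{x \<in> carrier E. (0::'k) \<in> UNIV} \<in> {{x \<in> carrier E. \<psi> x \<in> U} |\<psi> U. \<psi> \<in> dual E \<and> open U}"
      using z by (intro CollectI exI[of _ "\<lambda>_. 0"] exI[of _ UNIV]) auto
    then show "g s \<in> \<Union> {{x \<in> carrier E. \<psi> x \<in> U} |\<psi> U. \<psi> \<in> dual E \<and> open U}" using R by blast
  qed
qed

lemma weakly_continuous_real_functional_real:
  assumes "u \<in> dual (underlying_real (E :: (real, 'x) nvs))"
  shows "continuous_map (weak_topology E) euclideanreal u"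
  using assms by (simp add: dual_continuous_weak_topology)

text \<open>
  A real-linear \<open>u\<close> is the real part of the complex functional \<open>x \<mapsto> u x - \<i> u (\<i> x)\<close>, so it does not
  matter whether the weak topology is taken from real or from complex functionals.
\<close>

lemma weakly_continuous_real_functional_complex:
  assumes E: "normed_space (E :: (complex, 'x) nvs)" and u: "u \<in> dual (underlying_real E)"
  shows "continuous_map (weak_topology E) euclideanreal u"
proof -
  interpret normed_carrier E by unfold_locales (rule E)
  define \<psi> where "\<psi> x = Complex (u x) (- u (\<i> \<odot>\<^bsub>E\<^esub> x))" for x
  obtain K where K: "\<And>x. x \<in> carrier E \<Longrightarrow> \<bar>u x\<bar> \<le> K * vnorm E x"
    using normed_carrier.dual_bounded[OF _ u] normed_space_underlying_real by (auto simp: normed_carrier_def)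
  have u_add: "u (x \<oplus>\<^bsub>E\<^esub> y) = u x + u y" if "x \<in> carrier E" "y \<in> carrier E" for x y
    using u that by (auto simp: dual_def)
  have u_scale: "u (complex_of_real c \<odot>\<^bsub>E\<^esub> x) = c * u x" if "x \<in> carrier E" for x c
    using u that by (auto simp: dual_def)
  have "\<psi> \<in> dual E"
    unfolding dual_def mem_Collect_eq
  proof (intro conjI ballI allI exI)
    fix x y assume "x \<in> carrier E" "y \<in> carrier E"
    then show "\<psi> (x \<oplus>\<^bsub>E\<^esub> y) = \<psi> x + \<psi> y"
      by (simp add: \<psi>_def u_add scale_add_right complex_eq_iff)
  next
    fix x c assume x: "x \<in> carrier E"
    have i_times_c: "\<i> * c = Complex (- Im c) (Re c)" by (simp add: complex_eq_iff)
    have "u (Complex a b \<odot>\<^bsub>E\<^esub> x) = a * u x + b * u (\<i> \<odot>\<^bsub>E\<^esub> x)" for a b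
    proof -
      have "Complex a b \<odot>\<^bsub>E\<^esub> x = of_real a \<odot>\<^bsub>E\<^esub> x \<oplus>\<^bsub>E\<^esub> of_real b \<odot>\<^bsub>E\<^esub> (\<i> \<odot>\<^bsub>E\<^esub> x)"
        using x by (simp add: Complex_eq scale_add_left mult.commute)
      then show ?thesis using x u_scale[of x a] u_scale[of "\<i> \<odot>\<^bsub>E\<^esub> x" b] by (simp add: u_add del: scale_scale)
    qed
    from this[of "Re c" "Im c"] this[of "- Im c" "Re c"]
    have "u (c \<odot>\<^bsub>E\<^esub> x) = Re c * u x + Im c * u (\<i> \<odot>\<^bsub>E\<^esub> x)"
      "u (\<i> \<odot>\<^bsub>E\<^esub> (c \<odot>\<^bsub>E\<^esub> x)) = - Im c * u x + Re c * u (\<i> \<odot>\<^bsub>E\<^esub> x)"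
      using x by (simp_all add: i_times_c)
    then show "\<psi> (c \<odot>\<^bsub>E\<^esub> x) = c * \<psi> x"
      unfolding \<psi>_def by (simp add: complex_eq_iff)
  next
    fix x assume x: "x \<in> carrier E"
    have "norm (\<psi> x) \<le> \<bar>u x\<bar> + \<bar>u (\<i> \<odot>\<^bsub>E\<^esub> x)\<bar>" using cmod_le[of "\<psi> x"] by (simp add: \<psi>_def)
    also have "\<dots> \<le> K * vnorm E x + K * vnorm E x"
      using K[of x] K[of "\<i> \<odot>\<^bsub>E\<^esub> x"] x by (simp add: norm_scale)
    finally show "norm (\<psi> x) \<le> (2 * K) * vnorm E x" by simp
  qed
  then have "continuous_map (weak_topology E) euclideanreal (\<lambda>x. Re (\<psi> x))"
    using continuous_map_compose[OF dual_continuous_weak_topology, of \<psi> E euclideanreal Re]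
    by (simp add: o_def continuous_intros)
  then show ?thesis by (simp add: \<psi>_def)
qed

text \<open>
  Mazur-Orlicz for the norm and the ray through \<open>(y, \<parallel>y\<parallel>)\<close>.
\<close>

lemma (in normed_carrier) norming_functional:
  assumes y: "y \<in> carrier E"
  obtains u where "u \<in> dual (underlying_real E)" "\<And>x. x \<in> carrier E \<Longrightarrow> u x \<le> vnorm E x"
    "u y = vnorm E y"
proof -
  interpret R: real_vector_space_on "underlying_real E" by (rule real_vector_space_on_underlying_real)
  have p: "sublinear_on (underlying_real E) (vnorm E)"
    by (auto simp: sublinear_on_def norm_triangle norm_scale)
  define G where "G = {(of_real t \<odot> y, t * vnorm E y) | t. t \<ge> 0}"
  obtain u where u: "linear_on_carrier (underlying_real E) u" "\<And>x. x \<in> carrier E \<Longrightarrow> u x \<le> vnorm E x"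
    "\<And>w a. (w, a) \<in> G \<Longrightarrow> a \<le> u w"
  proof (rule R.mazur_orlicz[OF p, of G], goal_cases)
    case 1 show ?case using y by (auto simp: G_def)
  next
    case 2 show ?case unfolding G_def using y by (intro CollectI exI[of _ 0]) simp
  next
    case (3 w a w' a')
    then obtain t t' where "w = of_real t \<odot> y" "a = t * vnorm E y" "t \<ge> 0"
      "w' = of_real t' \<odot> y" "a' = t' * vnorm E y" "t' \<ge> 0" by (auto simp: G_def)
    then show ?case
      unfolding G_def using y by (auto intro!: exI[of _ "t + t'"] simp: scale_add_left distrib_right)
  next
    case (4 w a c)
    then obtain t where "w = of_real t \<odot> y" "a = t * vnorm E y" "t \<ge> 0" by (auto simp: G_def)
    then show ?case
      unfolding G_def using y \<open>c > 0\<close> by (auto intro!: exI[of _ "c * t"])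
  next
    case (5 w a) then show ?case using y by (auto simp: G_def norm_scale)
  qed auto
  have neg: "u (\<ominus>\<^bsub>E\<^esub> x) = - u x" if "x \<in> carrier E" for x
  proof -
    have "\<forall>c. u (of_real c \<odot> x) = c * u x" using u(1) that by (simp add: linear_on_carrier_def)
    from spec[OF this, of "- 1"] show ?thesis using that by (simp add: scale_minus_one)
  qed
  have abs: "\<bar>u x\<bar> \<le> vnorm E x" if "x \<in> carrier E" for x
    using u(2)[of x] u(2)[of "\<ominus>\<^bsub>E\<^esub> x"] that neg by (simp add: norm_minus)
  show thesis
  proof
    show "u \<in> dual (underlying_real E)"
      using u(1) abs by (auto simp: dual_def linear_on_carrier_def intro!: exI[of _ 1])
    have "(y, vnorm E y) \<in> G" using y by (auto simp: G_def intro!: exI[of _ 1])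
    then show "u y = vnorm E y" using u(2)[OF y] u(3) by (intro antisym) auto
  qed (fact u(2))
qed

section \<open>Spaces of bounded functions with the supremum norm\<close>

locale bounded_function_space =
  fixes F :: "('s \<Rightarrow> real) set"
  assumes zero_mem: "(\<lambda>_. 0) \<in> F"
    and add_mem: "\<And>f g. f \<in> F \<Longrightarrow> g \<in> F \<Longrightarrow> (\<lambda>t. f t + g t) \<in> F"
    and scale_mem: "\<And>f c. f \<in> F \<Longrightarrow> (\<lambda>t. c * f t) \<in> F"
    and bounded_mem: "\<And>f. f \<in> F \<Longrightarrow> bounded (range f)"
begin

lemma uminus_mem: "f \<in> F \<Longrightarrow> (\<lambda>t. - f t) \<in> F"
  using scale_mem[of f "- 1"] by simp

lemma diff_mem: "f \<in> F \<Longrightarrow> g \<in> F \<Longrightarrow> (\<lambda>t. f t - g t) \<in> F"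
  using add_mem[of f "\<lambda>t. - g t"] uminus_mem by simp

end

lemma abs_le_sup_norm:
  fixes f :: "'s \<Rightarrow> real"
  assumes "bounded (range f)"
  shows "\<bar>f t\<bar> \<le> (SUP t. \<bar>f t\<bar>)"
proof (rule cSUP_upper)
  show "bdd_above (range (\<lambda>t. \<bar>f t\<bar>))"
    using assms by (auto simp: bounded_iff bdd_above_def)
qed simp

text \<open>
  The functions are encoded by \<open>e\<close> and decoded by \<open>d\<close>: with identities this is \<open>C_r_space\<close>, and with
  the right injection it places a function space on the sum type over which the decomposition
  property quantifies.
\<close>

definition function_space_copy ::
    "(('s \<Rightarrow> real) \<Rightarrow> 'x) \<Rightarrow> ('x \<Rightarrow> 's \<Rightarrow> real) \<Rightarrow> ('s \<Rightarrow> real) set \<Rightarrow> (real, 'x) nvs" where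
  "function_space_copy e d F =
     \<lparr>carrier = e ` F, mult = (\<lambda>v w. e (\<lambda>t. d v t * d w t)), one = e (\<lambda>_. 1),
      zero = e (\<lambda>_. 0), add = (\<lambda>v w. e (\<lambda>t. d v t + d w t)), smult = (\<lambda>c v. e (\<lambda>t. c * d v t)),
      vnorm = (\<lambda>v. SUP t. \<bar>d v t\<bar>)\<rparr>"

lemma function_space_copy_simps [simp]:
  "carrier (function_space_copy e d F) = e ` F"
  "\<zero>\<^bsub>function_space_copy e d F\<^esub> = e (\<lambda>_. 0)"
  "v \<oplus>\<^bsub>function_space_copy e d F\<^esub> w = e (\<lambda>t. d v t + d w t)"
  "c \<odot>\<^bsub>function_space_copy e d F\<^esub> v = e (\<lambda>t. c * d v t)"
  "vnorm (function_space_copy e d F) v = (SUP t. \<bar>d v t\<bar>)"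
  by (simp_all add: function_space_copy_def)

lemma C_r_space_eq_copy: "C_r_space = function_space_copy (\<lambda>f. f) (\<lambda>f. f) C_r"
  by (simp add: C_r_space_def function_space_copy_def)

locale bounded_function_space_copy = bounded_function_space F
  for F :: "('s \<Rightarrow> real) set" +
  fixes e :: "('s \<Rightarrow> real) \<Rightarrow> 'x" and d :: "'x \<Rightarrow> 's \<Rightarrow> real"
  assumes decode_encode [simp]: "d (e f) = f"
begin

abbreviation Y :: "(real, 'x) nvs" where "Y \<equiv> function_space_copy e d F"

lemma normed_space_copy: "normed_space Y"
proof -
  have "abelian_group Y"
  proof (rule abelian_groupI)
    fix x assume "x \<in> carrier Y"
    then show "\<exists>y\<in>carrier Y. y \<oplus>\<^bsub>Y\<^esub> x = \<zero>\<^bsub>Y\<^esub>"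
      by (auto intro!: bexI[of _ "\<lambda>t. - (d x t)"] simp: uminus_mem)
  qed (auto simp: zero_mem add_mem algebra_simps)
  then have "module (scalars :: real ring) Y"
    by (intro moduleI cring_scalars) (auto simp: scale_mem algebra_simps)
  moreover have "0 \<le> vnorm Y x \<and> (vnorm Y x = 0 \<longleftrightarrow> x = \<zero>\<^bsub>Y\<^esub>)" if "x \<in> carrier Y" for x
  proof -
    obtain f where f: "f \<in> F" "x = e f" using \<open>x \<in> carrier Y\<close> by auto
    have le: "\<bar>f t\<bar> \<le> (SUP t. \<bar>f t\<bar>)" for t by (rule abs_le_sup_norm[OF bounded_mem[OF f(1)]])
    have "0 \<le> (SUP t. \<bar>f t\<bar>)" using le by (meson abs_ge_zero order_trans)
    moreover have "f = (\<lambda>_. 0)" if "(SUP t. \<bar>f t\<bar>) = 0" using le that by auto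
    moreover have "e f = e (\<lambda>_. 0) \<longleftrightarrow> f = (\<lambda>_. 0)" using decode_encode by metis
    ultimately show ?thesis using f(2) by auto
  qed
  moreover have "vnorm Y (c \<odot>\<^bsub>Y\<^esub> x) = norm c * vnorm Y x" if "x \<in> carrier Y" for x c
  proof -
    obtain f where f: "f \<in> F" "x = e f" using \<open>x \<in> carrier Y\<close> by auto
    have le: "\<bar>f t\<bar> \<le> (SUP t. \<bar>f t\<bar>)" for t by (rule abs_le_sup_norm[OF bounded_mem[OF f(1)]])
    have le': "\<bar>c * f t\<bar> \<le> (SUP t. \<bar>c * f t\<bar>)" for t
      by (rule abs_le_sup_norm[OF bounded_mem[OF scale_mem[OF f(1)]]])
    have "(SUP t. \<bar>c * f t\<bar>) = \<bar>c\<bar> * (SUP t. \<bar>f t\<bar>)"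
    proof (rule antisym)
      show "(SUP t. \<bar>c * f t\<bar>) \<le> \<bar>c\<bar> * (SUP t. \<bar>f t\<bar>)"
        by (rule cSUP_least) (auto simp: abs_mult intro!: mult_left_mono le)
      show "\<bar>c\<bar> * (SUP t. \<bar>f t\<bar>) \<le> (SUP t. \<bar>c * f t\<bar>)"
      proof (cases "c = 0")
        case False
        have "(SUP t. \<bar>f t\<bar>) \<le> (SUP t. \<bar>c * f t\<bar>) / \<bar>c\<bar>"
        proof (rule cSUP_least)
          fix t show "\<bar>f t\<bar> \<le> (SUP t. \<bar>c * f t\<bar>) / \<bar>c\<bar>"
            using le'[of t] False by (simp add: pos_le_divide_eq abs_mult mult.commute)
        qed simp
        then show ?thesis using False by (simp add: pos_le_divide_eq mult.commute)
      qed simp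
    qed
    then show ?thesis using f(2) by simp
  qed
  moreover have "vnorm Y (x \<oplus>\<^bsub>Y\<^esub> y) \<le> vnorm Y x + vnorm Y y" if "x \<in> carrier Y" "y \<in> carrier Y" for x y
  proof -
    obtain f g where fg: "f \<in> F" "x = e f" "g \<in> F" "y = e g" using \<open>x \<in> carrier Y\<close> \<open>y \<in> carrier Y\<close> by auto
    have "(SUP t. \<bar>f t + g t\<bar>) \<le> (SUP t. \<bar>f t\<bar>) + (SUP t. \<bar>g t\<bar>)"
    proof (rule cSUP_least)
      fix t show "\<bar>f t + g t\<bar> \<le> (SUP t. \<bar>f t\<bar>) + (SUP t. \<bar>g t\<bar>)"
        using abs_le_sup_norm[OF bounded_mem[OF fg(1)], of t] abs_le_sup_norm[OF bounded_mem[OF fg(3)], of t]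
        by linarith
    qed simp
    then show ?thesis using fg by simp
  qed
  ultimately show ?thesis unfolding normed_space_def by blast
qed

end

sublocale bounded_function_space_copy \<subseteq> copy: normed_carrier Y
  by unfold_locales (rule normed_space_copy)

context bounded_function_space_copy
begin

lemma minus_copy: "f \<in> F \<Longrightarrow> \<ominus>\<^bsub>Y\<^esub> e f = e (\<lambda>t. - f t)"
  by (rule copy.M.minus_equality) (auto intro: uminus_mem)

lemma diff_copy: "f \<in> F \<Longrightarrow> g \<in> F \<Longrightarrow> e f \<ominus>\<^bsub>Y\<^esub> e g = e (\<lambda>t. f t - g t)"
  by (simp add: copy.M.minus_eq minus_copy)

lemma abs_le_norm_copy: "f \<in> F \<Longrightarrow> \<bar>f t\<bar> \<le> vnorm Y (e f)"
  using abs_le_sup_norm[OF bounded_mem] by simp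

lemma norm_copy_le: "(\<And>t. \<bar>f t\<bar> \<le> B) \<Longrightarrow> vnorm Y (e f) \<le> B"
  by (simp add: cSUP_least)

text \<open>
  A Cauchy sequence for the supremum norm converges pointwise, and then uniformly, so that
  completeness reduces to closure under uniform approximation.
\<close>

lemma banach_space_copy:
  assumes uniform_limit: "\<And>f. (\<And>\<epsilon>. \<epsilon> > 0 \<Longrightarrow> \<exists>h\<in>F. \<forall>t. \<bar>h t - f t\<bar> \<le> \<epsilon>) \<Longrightarrow> f \<in> F"
  shows "banach_space Y"
  unfolding banach_space_def copy.metric.mcomplete_def
proof (intro conjI allI impI normed_space_copy)
  fix v assume "copy.metric.MCauchy v"
  then have v: "\<And>n. v n \<in> e ` F"
    and cauchy: "\<And>\<epsilon>. \<epsilon> > 0 \<Longrightarrow> \<exists>N. \<forall>n n'. N \<le> n \<longrightarrow> N \<le> n' \<longrightarrow> vdist Y (v n) (v n') < \<epsilon>"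
    unfolding copy.metric.MCauchy_def by (auto simp: image_subset_iff)
  define h where "h n = d (v n)" for n
  have h: "h n \<in> F" "v n = e (h n)" for n using v[of n] by (auto simp: h_def)
  have near: "\<exists>N. \<forall>n\<ge>N. \<forall>n'\<ge>N. \<forall>t. \<bar>h n t - h n' t\<bar> < \<epsilon>" if \<epsilon>: "\<epsilon> > 0" for \<epsilon>
  proof -
    obtain N where N: "\<forall>n n'. N \<le> n \<longrightarrow> N \<le> n' \<longrightarrow> vdist Y (v n) (v n') < \<epsilon>" using cauchy[OF \<epsilon>] by blast
    have "\<bar>h n t - h n' t\<bar> < \<epsilon>" if "n \<ge> N" "n' \<ge> N" for n n' t
    proof -
      have "\<bar>h n t - h n' t\<bar> \<le> vnorm Y (e (\<lambda>t. h n t - h n' t))"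
        using abs_le_norm_copy[OF diff_mem[OF h(1)[of n] h(1)[of n']], of t] .
      also have "\<dots> = vdist Y (v n) (v n')" using h by (simp add: vdist_def diff_copy)
      also have "\<dots> < \<epsilon>" using N that by blast
      finally show ?thesis .
    qed
    then show ?thesis by blast
  qed
  have "Cauchy (\<lambda>n. h n t)" for t
    unfolding Cauchy_def dist_real_def
  proof (intro allI impI)
    fix \<epsilon> :: real assume "\<epsilon> > 0"
    from near[OF this] show "\<exists>N. \<forall>m\<ge>N. \<forall>n\<ge>N. \<bar>h m t - h n t\<bar> < \<epsilon>" by metis
  qed
  then have conv: "(\<lambda>n. h n t) \<longlonglongrightarrow> lim (\<lambda>n. h n t)" for t
    by (simp add: Cauchy_convergent_iff convergent_LIMSEQ_iff)
  define f where "f t = lim (\<lambda>n. h n t)" for t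
  have unif: "\<exists>N. \<forall>n\<ge>N. \<forall>t. \<bar>h n t - f t\<bar> \<le> \<epsilon>" if \<epsilon>: "\<epsilon> > 0" for \<epsilon>
  proof -
    obtain N where N: "\<And>n n' t. n \<ge> N \<Longrightarrow> n' \<ge> N \<Longrightarrow> \<bar>h n t - h n' t\<bar> < \<epsilon>" using near[OF \<epsilon>] by blast
    have "\<bar>h n t - f t\<bar> \<le> \<epsilon>" if "n \<ge> N" for n t
    proof (rule LIMSEQ_le_const2)
      show "(\<lambda>n'. \<bar>h n t - h n' t\<bar>) \<longlonglongrightarrow> \<bar>h n t - f t\<bar>"
        unfolding f_def by (intro tendsto_intros conv)
      show "\<exists>N. \<forall>n'\<ge>N. \<bar>h n t - h n' t\<bar> \<le> \<epsilon>" using N[OF that] less_imp_le by blast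
    qed
    then show ?thesis by blast
  qed
  have f: "f \<in> F" using unif h(1) by (intro uniform_limit) blast
  have "limitin (norm_topology Y) v (e f) sequentially"
    unfolding copy.limit_norm_topology_iff
  proof (intro conjI allI impI)
    show "e f \<in> carrier Y" using f by simp
    fix \<epsilon> :: real assume "\<epsilon> > 0"
    then obtain N where N: "\<forall>n\<ge>N. \<forall>t. \<bar>h n t - f t\<bar> \<le> \<epsilon> / 2" using unif[of "\<epsilon> / 2"] by auto
    have "v n \<in> carrier Y \<and> vnorm Y (v n \<ominus>\<^bsub>Y\<^esub> e f) < \<epsilon>" if "n \<ge> N" for n
    proof -
      have "vnorm Y (e (\<lambda>t. h n t - f t)) \<le> \<epsilon> / 2" using N that by (intro norm_copy_le) blast
      then show ?thesis using \<open>\<epsilon> > 0\<close> h f by (simp add: diff_copy del: function_space_copy_simps(5))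
    qed
    then show "\<exists>N. \<forall>n\<ge>N. v n \<in> carrier Y \<and> vnorm Y (v n \<ominus>\<^bsub>Y\<^esub> e f) < \<epsilon>" by blast
  qed
  then show "\<exists>x. limitin copy.metric.mtopology v x sequentially"
    by (auto simp: copy.norm_topology_eq)
qed

end

lemma bounded_function_space_C_r: "bounded_function_space (C_r :: ('s::{semigroup_mult, topological_space} \<Rightarrow> real) set)"
proof
  show "(\<lambda>_. 0) \<in> (C_r :: ('s \<Rightarrow> real) set)" by (simp add: C_r_def bcontfun_def translate_def)
  show "bounded (range f)" if "f \<in> C_r" for f :: "'s \<Rightarrow> real"
    using that by (simp add: C_r_def bcontfun_def)
  show "(\<lambda>t. f t + g t) \<in> C_r" if "f \<in> C_r" "g \<in> C_r" for f g :: "'s \<Rightarrow> real"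
    using that by (auto simp: C_r_def bcontfun_def translate_def intro!: continuous_intros bounded_plus_comp)
  show "(\<lambda>t. c * f t) \<in> C_r" if "f \<in> C_r" for f :: "'s \<Rightarrow> real" and c
  proof -
    obtain B where "\<forall>t. \<bar>f t\<bar> \<le> B" using \<open>f \<in> C_r\<close> by (auto simp: C_r_def bcontfun_def bounded_iff)
    then have "\<bar>c * f t\<bar> \<le> \<bar>c\<bar> * B" for t by (simp add: abs_mult mult_left_mono)
    then have "bounded (range (\<lambda>t. c * f t))" by (auto simp: bounded_iff)
    then show ?thesis
      using that by (auto simp: C_r_def bcontfun_def translate_def intro!: continuous_intros)
  qed
qed

interpretation C_r: bounded_function_space_copy C_r "\<lambda>f. f" "\<lambda>f. f"
  rewrites "function_space_copy (\<lambda>f. f) (\<lambda>f. f) C_r = C_r_space"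
  by (simp_all add: bounded_function_space_copy_def bounded_function_space_copy_axioms_def
      bounded_function_space_C_r C_r_space_eq_copy)

lemma C_r_space_simps [simp]:
  "carrier C_r_space = C_r"
  "\<zero>\<^bsub>C_r_space\<^esub> = (\<lambda>_. 0)"
  "f \<oplus>\<^bsub>C_r_space\<^esub> g = (\<lambda>t. f t + g t)"
  "c \<odot>\<^bsub>C_r_space\<^esub> f = (\<lambda>t. c * f t)"
  "vnorm C_r_space f = (SUP t. \<bar>f t\<bar>)"
  by (simp_all add: C_r_space_def)

lemma (in normed_carrier) continuous_map_norm_topologyD:
  assumes "continuous_map euclidean (norm_topology E) g" "\<epsilon> > 0"
  shows "\<exists>U. open U \<and> s \<in> U \<and> (\<forall>t\<in>U. vnorm E (g t \<ominus>\<^bsub>E\<^esub> g s) < \<epsilon>)"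
  using assms unfolding continuous_map_norm_topology_iff by blast

section \<open>Orbit functions of bounded representations\<close>

locale bounded_representation = normed_carrier E
  for E :: "('k::real_normed_field, 'x) nvs" (structure) +
  fixes \<Phi> :: "'s::{semigroup_mult, topological_space} \<Rightarrow> 'x \<Rightarrow> 'x" and M :: real
  assumes hom: "operator_homomorphism E \<Phi>"
    and bound_nonneg: "0 \<le> M"
    and bound: "\<And>s x. x \<in> carrier E \<Longrightarrow> vnorm E (\<Phi> s x) \<le> M * vnorm E x"
begin

lemma rep_closed [simp]: "x \<in> carrier E \<Longrightarrow> \<Phi> s x \<in> carrier E"
  using hom by (auto simp: operator_homomorphism_def bounded_operators_def)
lemma rep_add:
  "x \<in> carrier E \<Longrightarrow> y \<in> carrier E \<Longrightarrow> \<Phi> s (x \<oplus>\<^bsub>E\<^esub> y) = \<Phi> s x \<oplus>\<^bsub>E\<^esub> \<Phi> s y"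
  using hom by (auto simp: operator_homomorphism_def bounded_operators_def)
lemma rep_scale: "x \<in> carrier E \<Longrightarrow> \<Phi> s (c \<odot> x) = c \<odot> \<Phi> s x"
  using hom by (auto simp: operator_homomorphism_def bounded_operators_def)
lemma rep_mult: "x \<in> carrier E \<Longrightarrow> \<Phi> (s * t) x = \<Phi> s (\<Phi> t x)"
  using hom by (auto simp: operator_homomorphism_def compose_def)
lemma rep_diff:
  "x \<in> carrier E \<Longrightarrow> y \<in> carrier E \<Longrightarrow> \<Phi> s (x \<ominus>\<^bsub>E\<^esub> y) = \<Phi> s x \<ominus>\<^bsub>E\<^esub> \<Phi> s y"
  using rep_add[of x "(- 1) \<odot> y" s] rep_scale[of y s "- 1"] by (simp add: M.minus_eq scale_minus_one)

definition orbit :: "('x \<Rightarrow> real) \<Rightarrow> 'x \<Rightarrow> 's \<Rightarrow> real" where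
  "orbit u x s = u (\<Phi> s x)"

lemma translate_orbit: "x \<in> carrier E \<Longrightarrow> translate (orbit u x) = (\<lambda>s. orbit u (\<Phi> s x))"
  by (simp add: translate_def orbit_def rep_mult fun_eq_iff)

context
  fixes u assumes u: "u \<in> dual (underlying_real E)"
begin

lemma functional_add: "x \<in> carrier E \<Longrightarrow> y \<in> carrier E \<Longrightarrow> u (x \<oplus>\<^bsub>E\<^esub> y) = u x + u y"
  using u by (auto simp: dual_def)

lemma functional_scale: "x \<in> carrier E \<Longrightarrow> u (of_real c \<odot> x) = c * u x"
  using u by (auto simp: dual_def)

text \<open>
  Although \<open>u\<close> is only real-linear, scalars of the field act on the set of these functionals; this
  replaces complex linearity of a single functional in what follows.
\<close>

lemma functional_scaled_mem: "(\<lambda>x. u (c \<odot> x)) \<in> dual (underlying_real E)"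
proof -
  interpret real: normed_carrier "underlying_real E"
    by unfold_locales (rule normed_space_underlying_real)
  obtain K where "K \<ge> 0" and K: "\<And>x. x \<in> carrier E \<Longrightarrow> \<bar>u x\<bar> \<le> K * vnorm E x"
    using real.dual_bounded[OF u] by auto
  have "\<bar>u (c \<odot> x)\<bar> \<le> (K * norm c) * vnorm E x" if "x \<in> carrier E" for x
    using K[of "c \<odot> x"] that by (simp add: norm_scale mult.assoc)
  moreover have "u (c \<odot> (of_real a \<odot> x)) = a * u (c \<odot> x)" if "x \<in> carrier E" for a x
    using functional_scale[of "c \<odot> x" a] that by (simp add: mult.commute)
  ultimately show ?thesis
    by (auto simp: dual_def scale_add_right functional_add simp del: scale_scale)
qed

lemma orbit_add:
  "x \<in> carrier E \<Longrightarrow> y \<in> carrier E \<Longrightarrow> orbit u (x \<oplus>\<^bsub>E\<^esub> y) = (\<lambda>t. orbit u x t + orbit u y t)"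
  by (simp add: orbit_def rep_add functional_add fun_eq_iff)

lemma orbit_scale: "x \<in> carrier E \<Longrightarrow> orbit u (of_real c \<odot> x) = (\<lambda>t. c * orbit u x t)"
  by (simp add: orbit_def rep_scale functional_scale fun_eq_iff)

lemma orbit_diff:
  assumes "x \<in> carrier E" "y \<in> carrier E"
  shows "orbit u (x \<ominus>\<^bsub>E\<^esub> y) = (\<lambda>t. orbit u x t - orbit u y t)"
  using assms orbit_add[of x "of_real (- 1) \<odot> y"] orbit_scale[of y "- 1"]
  by (simp add: M.minus_eq scale_minus_one)

lemma orbit_bounded:
  obtains K where "K \<ge> 0" "\<And>x t. x \<in> carrier E \<Longrightarrow> \<bar>orbit u x t\<bar> \<le> K * vnorm E x"
proof -
  interpret real: normed_carrier "underlying_real E"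
    by unfold_locales (rule normed_space_underlying_real)
  obtain K where "K \<ge> 0" and K: "\<And>x. x \<in> carrier E \<Longrightarrow> \<bar>u x\<bar> \<le> K * vnorm E x"
    using real.dual_bounded[OF u] by auto
  show thesis
  proof (rule that[of "K * M"])
    fix x t assume x: "x \<in> carrier E"
    have "\<bar>orbit u x t\<bar> \<le> K * vnorm E (\<Phi> t x)" using K x by (simp add: orbit_def)
    also have "\<dots> \<le> K * (M * vnorm E x)" using bound[OF x] \<open>K \<ge> 0\<close> by (rule mult_left_mono)
    finally show "\<bar>orbit u x t\<bar> \<le> K * M * vnorm E x" by (simp add: mult.assoc)
  qed (simp add: \<open>K \<ge> 0\<close> bound_nonneg)
qed

lemma orbit_in_C_r:
  assumes cont: "\<And>x. x \<in> carrier E \<Longrightarrow> continuous_on UNIV (\<lambda>s. u (\<Phi> s x))" and x: "x \<in> carrier E"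
  shows "orbit u x \<in> C_r"
proof -
  obtain K where "K \<ge> 0" and K: "\<And>x t. x \<in> carrier E \<Longrightarrow> \<bar>orbit u x t\<bar> \<le> K * vnorm E x"
    by (rule orbit_bounded) (rule that, assumption, simp)
  have "bounded (range (orbit u x))" using K[OF x] by (auto simp: bounded_iff)
  moreover have "continuous_on UNIV (orbit u y)" if "y \<in> carrier E" for y
    unfolding orbit_def[abs_def] by (rule cont[OF that])
  ultimately show ?thesis
    using x by (simp add: C_r_def bcontfun_def translate_orbit)
qed

text \<open>
  A functional \<open>\<psi>\<close> on \<open>C_r\<close>, composed with \<open>y \<mapsto> orbit u y\<close>, is a bounded real functional on the
  representation space itself, so weak continuity of \<open>s \<mapsto> \<Phi> s x\<close> there passes to the translates of the orbit
  function. The second continuity condition in \<open>C_weak\<close> is the first one at the point \<open>\<Phi> t x\<close>.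
\<close>

lemma orbit_in_C_weak:
  assumes cont: "\<And>v x. v \<in> dual (underlying_real E) \<Longrightarrow> x \<in> carrier E \<Longrightarrow> continuous_on UNIV (\<lambda>s. v (\<Phi> s x))"
    and x: "x \<in> carrier E"
  shows "orbit u x \<in> C_weak"
proof -
  have C_r: "orbit u y \<in> C_r" if "y \<in> carrier E" for y
    using cont[OF u] that by (rule orbit_in_C_r)
  have pull: "(\<lambda>y. \<psi> (orbit u y)) \<in> dual (underlying_real E)" if \<psi>: "\<psi> \<in> dual C_r_space" for \<psi>
  proof -
    obtain L where "L \<ge> 0" and L: "\<And>f. f \<in> C_r \<Longrightarrow> \<bar>\<psi> f\<bar> \<le> L * vnorm C_r_space f"
      using C_r.copy.dual_bounded[OF \<psi>] by auto
    obtain K where "K \<ge> 0" and K: "\<And>x t. x \<in> carrier E \<Longrightarrow> \<bar>orbit u x t\<bar> \<le> K * vnorm E x"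
    by (rule orbit_bounded) (rule that, assumption, simp)
    have "\<bar>\<psi> (orbit u y)\<bar> \<le> (L * K) * vnorm E y" if y: "y \<in> carrier E" for y
    proof -
      have "\<bar>\<psi> (orbit u y)\<bar> \<le> L * vnorm C_r_space (orbit u y)" using L C_r[OF y] by blast
      also have "\<dots> \<le> L * (K * vnorm E y)"
        using K[OF y] \<open>L \<ge> 0\<close> by (intro mult_left_mono C_r.norm_copy_le)
      finally show ?thesis by (simp add: mult.assoc)
    qed
    moreover have "\<psi> (\<lambda>t. f t + g t) = \<psi> f + \<psi> g" if "f \<in> C_r" "g \<in> C_r" for f g
      using \<psi> that by (auto simp: dual_def)
    moreover have "\<psi> (\<lambda>t. c * f t) = c * \<psi> f" if "f \<in> C_r" for f c
      using \<psi> that by (auto simp: dual_def)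
    ultimately show ?thesis by (auto simp: dual_def orbit_add orbit_scale C_r)
  qed
  have "continuous_map euclidean (weak_topology C_r_space) (\<lambda>s. orbit u (\<Phi> s y))" if "y \<in> carrier E" for y
    using cont[OF pull] that C_r by (simp add: continuous_map_weak_topology_iff)
  then show ?thesis
    using C_r x by (simp add: C_weak_def translate_orbit rep_mult)
qed

text \<open>
  The map \<open>y \<mapsto> orbit u y\<close> is bounded for the supremum norm, so it carries norm continuity of
  \<open>s \<mapsto> \<Phi> s x\<close> to the translates of the orbit function.
\<close>

lemma orbit_in_C_norm:
  assumes cont: "\<And>x. x \<in> carrier E \<Longrightarrow> continuous_map euclidean (norm_topology E) (\<lambda>s. \<Phi> s x)"
    and x: "x \<in> carrier E"
  shows "orbit u x \<in> C_norm"
proof -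
  obtain K where "K \<ge> 0" and K: "\<And>x t. x \<in> carrier E \<Longrightarrow> \<bar>orbit u x t\<bar> \<le> K * vnorm E x"
    by (rule orbit_bounded) (rule that, assumption, simp)
  have near: "\<exists>U. open U \<and> s \<in> U \<and> (\<forall>t\<in>U. \<forall>r. \<bar>orbit u (\<Phi> t y) r - orbit u (\<Phi> s y) r\<bar> \<le> \<epsilon>)"
    if y: "y \<in> carrier E" and \<epsilon>: "\<epsilon> > 0" for y s \<epsilon>
  proof -
    have "\<epsilon> / (K + 1) > 0" using \<epsilon> \<open>K \<ge> 0\<close> by simp
    from continuous_map_norm_topologyD[OF cont[OF y] this, of s] obtain U where U: "open U" "s \<in> U" "\<And>t. t \<in> U \<Longrightarrow> vnorm E (\<Phi> t y \<ominus>\<^bsub>E\<^esub> \<Phi> s y) < \<epsilon> / (K + 1)"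
      by auto
    have "\<bar>orbit u (\<Phi> t y) r - orbit u (\<Phi> s y) r\<bar> \<le> \<epsilon>" if t: "t \<in> U" for t r
    proof -
      have "\<bar>orbit u (\<Phi> t y) r - orbit u (\<Phi> s y) r\<bar> = \<bar>orbit u (\<Phi> t y \<ominus>\<^bsub>E\<^esub> \<Phi> s y) r\<bar>"
        using y by (simp add: orbit_diff)
      also have "\<dots> \<le> K * vnorm E (\<Phi> t y \<ominus>\<^bsub>E\<^esub> \<Phi> s y)" using y by (intro K) simp
      also have "\<dots> \<le> K * (\<epsilon> / (K + 1))" using U(3)[OF t] \<open>K \<ge> 0\<close> by (intro mult_left_mono) auto
      also have "\<dots> \<le> \<epsilon>" using \<open>K \<ge> 0\<close> \<epsilon> by (simp add: pos_divide_le_eq algebra_simps)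
      finally show ?thesis .
    qed
    with U show ?thesis by blast
  qed
  have "continuous_on UNIV (\<lambda>s. u (\<Phi> s y))" if y: "y \<in> carrier E" for y
  proof -
    interpret real: normed_carrier "underlying_real E"
      by unfold_locales (rule normed_space_underlying_real)
    obtain L where "L \<ge> 0" and L: "\<And>x. x \<in> carrier E \<Longrightarrow> \<bar>u x\<bar> \<le> L * vnorm E x"
      using real.dual_bounded[OF u] by auto
    show ?thesis
      unfolding continuous_on_topological
    proof (intro ballI allI impI)
      fix s B assume B: "open B" "u (\<Phi> s y) \<in> B"
      then obtain \<epsilon> where \<epsilon>: "\<epsilon> > 0" "ball (u (\<Phi> s y)) \<epsilon> \<subseteq> B" by (auto simp: open_contains_ball)
      have "\<epsilon> / (L + 1) > 0" using \<epsilon> \<open>L \<ge> 0\<close> by simp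
      from continuous_map_norm_topologyD[OF cont[OF y] this, of s] obtain U where U: "open U" "s \<in> U" "\<And>t. t \<in> U \<Longrightarrow> vnorm E (\<Phi> t y \<ominus>\<^bsub>E\<^esub> \<Phi> s y) < \<epsilon> / (L + 1)"
      by auto
      have "u (\<Phi> t y) \<in> B" if t: "t \<in> U" for t
      proof -
        have "u (\<Phi> t y) - u (\<Phi> s y) = u (\<Phi> t y \<ominus>\<^bsub>E\<^esub> \<Phi> s y)"
          using functional_add[of "\<Phi> t y" "of_real (- 1) \<odot> \<Phi> s y"] functional_scale[of "\<Phi> s y" "- 1"] y
          by (simp add: M.minus_eq scale_minus_one)
        then have "\<bar>u (\<Phi> t y) - u (\<Phi> s y)\<bar> \<le> L * vnorm E (\<Phi> t y \<ominus>\<^bsub>E\<^esub> \<Phi> s y)"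
          using L[of "\<Phi> t y \<ominus>\<^bsub>E\<^esub> \<Phi> s y"] y by simp
        also have "\<dots> \<le> L * (\<epsilon> / (L + 1))" using U(3)[OF t] \<open>L \<ge> 0\<close> by (intro mult_left_mono) auto
        also have "\<dots> < \<epsilon>" using \<open>L \<ge> 0\<close> \<epsilon> by (simp add: pos_divide_less_eq algebra_simps)
        finally show ?thesis using \<epsilon>(2) by (auto simp: dist_real_def abs_minus_commute)
      qed
      with U show "\<exists>A. open A \<and> s \<in> A \<and> (\<forall>t\<in>UNIV. t \<in> A \<longrightarrow> u (\<Phi> t y) \<in> B)" by blast
    qed
  qed
  then have C_r: "orbit u y \<in> C_r" if "y \<in> carrier E" for y
    using that by (rule orbit_in_C_r)
  have "continuous_map euclidean (norm_topology C_r_space) (\<lambda>s. orbit u (\<Phi> s y))" if y: "y \<in> carrier E" for y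
    unfolding C_r.copy.continuous_map_norm_topology_iff
  proof (intro conjI allI impI)
    fix s and \<epsilon> :: real assume "\<epsilon> > 0"
    then obtain U where U: "open U" "s \<in> U"
      "\<And>t r. t \<in> U \<Longrightarrow> \<bar>orbit u (\<Phi> t y) r - orbit u (\<Phi> s y) r\<bar> \<le> \<epsilon> / 2"
      using near[OF y, of "\<epsilon> / 2" s] by auto
    have "vnorm C_r_space (orbit u (\<Phi> t y) \<ominus>\<^bsub>C_r_space\<^esub> orbit u (\<Phi> s y)) < \<epsilon>" if "t \<in> U" for t
    proof -
      have "vnorm C_r_space (\<lambda>r. orbit u (\<Phi> t y) r - orbit u (\<Phi> s y) r) \<le> \<epsilon> / 2"
        using U(3)[OF that] by (rule C_r.norm_copy_le)
      then show ?thesis using \<open>\<epsilon> > 0\<close> y C_r by (simp add: C_r.diff_copy del: C_r_space_simps(5))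
    qed
    with U show "\<exists>U. open U \<and> s \<in> U \<and>
        (\<forall>t\<in>U. vnorm C_r_space (orbit u (\<Phi> t y) \<ominus>\<^bsub>C_r_space\<^esub> orbit u (\<Phi> s y)) < \<epsilon>)" by blast
  qed (use C_r y in simp)
  then show ?thesis
    using C_r x by (simp add: C_norm_def translate_orbit rep_mult)
qed

end
end

section \<open>From an invariant mean to the decomposition\<close>

context bounded_representation
begin

abbreviation displacements :: "'x set" where
  "displacements \<equiv> (\<Union>s. (\<lambda>x. \<Phi> s x \<ominus>\<^bsub>E\<^esub> x) ` carrier E)"

abbreviation displacement_span :: "'x set" where
  "displacement_span \<equiv> (\<lambda>W. submodule W (scalars :: 'k ring) E) hull displacements"

lemma displacements_subset: "displacements \<subseteq> carrier E" by auto

lemma submodule_displacement_span: "submodule displacement_span scalars E"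
  by (rule submodule_hull[OF displacements_subset])

lemma submodule_range_part: "submodule (range_part E \<Phi>) scalars E"
  unfolding range_part_def by (rule submodule_closed_span[OF displacements_subset])

lemma null_part_iff: "y \<in> null_part E \<Phi> \<longleftrightarrow> y \<in> carrier E \<and> (\<forall>s. \<Phi> s y = y)"
  by (auto simp: null_part_def diff_eq_zero)

lemma submodule_null_part: "submodule (null_part E \<Phi>) scalars E"
proof (rule submoduleI)
  have scale: "c \<odot> x \<in> null_part E \<Phi>" if "x \<in> null_part E \<Phi>" for c x
    using that by (auto simp: null_part_iff rep_scale)
  show "\<zero>\<^bsub>E\<^esub> \<in> null_part E \<Phi>"
    using rep_scale[of "\<zero>\<^bsub>E\<^esub>" _ 0] by (auto simp: null_part_iff)
  show "\<ominus>\<^bsub>E\<^esub> x \<in> null_part E \<Phi>" if "x \<in> null_part E \<Phi>" for x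
    using scale[OF that, of "- 1"] that by (simp add: scale_minus_one null_part_iff)
  show "c \<odot> x \<in> null_part E \<Phi>" if "x \<in> null_part E \<Phi>" for c x
    by (rule scale[OF that])
qed (auto simp: null_part_iff rep_add)

text \<open>
  On a displacement, the orbit function is a difference \<open>translate f s - f\<close>. The vectors on which
  the claim holds for all \<open>u\<close> simultaneously form a submodule; for one fixed \<open>u\<close> they need not be
  closed under complex scalars.
\<close>

lemma invariant_mean_vanishes_on_displacement_span:
  assumes mean: "right_invariant_mean_on F \<phi>"
    and orbit_mem: "\<And>u x. u \<in> dual (underlying_real E) \<Longrightarrow> x \<in> carrier E \<Longrightarrow> orbit u x \<in> F"
    and z: "z \<in> displacement_span" and u: "u \<in> dual (underlying_real E)"
  shows "\<phi> (orbit u z) = 0"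
proof -
  have mean_add: "\<phi> (\<lambda>t. f t + g t) = \<phi> f + \<phi> g" if "f \<in> F" "g \<in> F" for f g
    using mean that by (auto simp: right_invariant_mean_on_def mean_on_def)
  have mean_scale: "\<phi> (\<lambda>t. c * f t) = c * \<phi> f" if "f \<in> F" for f c
    using mean that by (auto simp: right_invariant_mean_on_def mean_on_def)
  have mean_translate: "\<phi> (translate f s) = \<phi> f" if "f \<in> F" for f s
    using mean that by (auto simp: right_invariant_mean_on_def)
  define H where "H = {x \<in> carrier E. \<forall>u\<in>dual (underlying_real E). \<phi> (orbit u x) = 0}"
  have "submodule H scalars E"
  proof (rule submoduleI)
    have scale: "c \<odot> x \<in> H" if x: "x \<in> H" for c x
    proof -
      have "\<phi> (orbit v (c \<odot> x)) = 0" if v: "v \<in> dual (underlying_real E)" for v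
      proof -
        have "orbit v (c \<odot> x) = orbit (\<lambda>y. v (c \<odot> y)) x"
          using x by (auto simp: orbit_def H_def rep_scale)
        then show ?thesis using x functional_scaled_mem[OF v, of c] by (simp add: H_def)
      qed
      then show ?thesis using x by (simp add: H_def)
    qed
    show "\<zero>\<^bsub>E\<^esub> \<in> H"
    proof -
      have "\<phi> (orbit v \<zero>\<^bsub>E\<^esub>) = 0" if v: "v \<in> dual (underlying_real E)" for v
        using orbit_scale[OF v, of "\<zero>\<^bsub>E\<^esub>" 0] mean_scale[OF orbit_mem[OF v, of "\<zero>\<^bsub>E\<^esub>"], of 0] by simp
      then show ?thesis by (simp add: H_def)
    qed
    show "\<ominus>\<^bsub>E\<^esub> x \<in> H" if "x \<in> H" for x
      using scale[OF that, of "- 1"] that by (simp add: scale_minus_one H_def)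
    show "x \<oplus>\<^bsub>E\<^esub> y \<in> H" if "x \<in> H" "y \<in> H" for x y
      using that by (simp add: H_def orbit_add mean_add orbit_mem)
    show "c \<odot> x \<in> H" if "x \<in> H" for c x by (rule scale[OF that])
  qed (auto simp: H_def)
  moreover have "displacements \<subseteq> H"
  proof safe
    fix s x assume x: "x \<in> carrier E"
    have "\<phi> (orbit v (\<Phi> s x \<ominus>\<^bsub>E\<^esub> x)) = 0" if v: "v \<in> dual (underlying_real E)" for v
    proof -
      have "orbit v (\<Phi> s x \<ominus>\<^bsub>E\<^esub> x) = (\<lambda>t. orbit v (\<Phi> s x) t + (- 1) * orbit v x t)"
        using x v by (simp add: orbit_diff)
      then have "\<phi> (orbit v (\<Phi> s x \<ominus>\<^bsub>E\<^esub> x)) = \<phi> (\<lambda>t. orbit v (\<Phi> s x) t + (- 1) * orbit v x t)"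
        by simp
      also have "\<dots> = \<phi> (orbit v (\<Phi> s x)) + \<phi> (\<lambda>t. (- 1) * orbit v x t)"
        using x orbit_mem[OF v, of x] orbit_mem[OF v, of "\<Phi> s x"]
          orbit_scale[OF v x, of "- 1"] orbit_mem[OF v, of "of_real (- 1) \<odot> x"]
        by (intro mean_add) auto
      also have "\<dots> = \<phi> (orbit v (\<Phi> s x)) - \<phi> (orbit v x)"
        using mean_scale[OF orbit_mem[OF v x], of "- 1"] by simp
      also have "\<dots> = 0"
        using mean_translate[OF orbit_mem[OF v x], of s] x by (simp add: translate_orbit)
      finally show ?thesis .
    qed
    then show "\<Phi> s x \<ominus>\<^bsub>E\<^esub> x \<in> H" using x by (simp add: H_def)
  qed
  ultimately have "displacement_span \<subseteq> H" by (intro hull_minimal)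
  then show ?thesis using z u by (auto simp: H_def)
qed

text \<open>
  The orbit function of the fixed vector \<open>y\<close> under a norming functional is constantly \<open>\<parallel>y\<parallel>\<close>, so
  the mean of the orbit function of \<open>y + w\<close> is \<open>\<parallel>y\<parallel>\<close> for every \<open>w\<close> in the span of the
  displacements, while its supremum is at most \<open>M \<parallel>y + w\<parallel>\<close>. Approximation extends the estimate to
  the closed span.
\<close>

lemma norm_null_le_of_invariant_mean:
  assumes mean: "right_invariant_mean_on F \<phi>"
    and orbit_mem: "\<And>u x. u \<in> dual (underlying_real E) \<Longrightarrow> x \<in> carrier E \<Longrightarrow> orbit u x \<in> F"
    and y: "y \<in> null_part E \<Phi>" and z: "z \<in> range_part E \<Phi>"
  shows "vnorm E y \<le> M * vnorm E (y \<oplus>\<^bsub>E\<^esub> z)"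
proof -
  have y': "y \<in> carrier E" "\<And>s. \<Phi> s y = y" using y by (auto simp: null_part_iff)
  have z': "z \<in> carrier E" using z submoduleE(1)[OF submodule_range_part] by auto
  have le: "vnorm E y \<le> M * vnorm E (y \<oplus>\<^bsub>E\<^esub> w)" if w: "w \<in> displacement_span" for w
  proof -
    have w': "w \<in> carrier E" using w submoduleE(1)[OF submodule_displacement_span] by auto
    obtain u where u: "u \<in> dual (underlying_real E)" "\<And>x. x \<in> carrier E \<Longrightarrow> u x \<le> vnorm E x"
      "u y = vnorm E y"
      using norming_functional[OF y'(1)] by blast
    let ?f = "orbit u (y \<oplus>\<^bsub>E\<^esub> w)"
    have orbit_y: "orbit u y = (\<lambda>_. vnorm E y)" using y'(2) u(3) by (simp add: orbit_def fun_eq_iff)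
    have "\<phi> ?f = \<phi> (orbit u y) + \<phi> (orbit u w)"
      using mean orbit_mem[OF u(1)] y' w' by (simp add: orbit_add[OF u(1)] right_invariant_mean_on_def mean_on_def)
    moreover have "\<phi> (orbit u w) = 0"
      using invariant_mean_vanishes_on_displacement_span[OF mean orbit_mem w u(1)] .
    moreover have "(INF t. orbit u y t) \<le> \<phi> (orbit u y)"
      using mean orbit_mem[OF u(1) y'(1)] by (simp add: right_invariant_mean_on_def mean_on_def)
    then have "vnorm E y \<le> \<phi> (orbit u y)" by (simp add: orbit_y)
    ultimately have "vnorm E y \<le> \<phi> ?f" by simp
    also have "\<dots> \<le> (SUP t. ?f t)"
      using mean orbit_mem[OF u(1), of "y \<oplus>\<^bsub>E\<^esub> w"] y' w' by (simp add: right_invariant_mean_on_def mean_on_def)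
    also have "\<dots> \<le> M * vnorm E (y \<oplus>\<^bsub>E\<^esub> w)"
    proof (rule cSUP_least)
      fix t
      have "?f t \<le> vnorm E (\<Phi> t (y \<oplus>\<^bsub>E\<^esub> w))" unfolding orbit_def using u(2) y' w' by simp
      also have "\<dots> \<le> M * vnorm E (y \<oplus>\<^bsub>E\<^esub> w)" using y' w' by (intro bound) simp
      finally show "?f t \<le> M * vnorm E (y \<oplus>\<^bsub>E\<^esub> w)" .
    qed simp
    finally show ?thesis .
  qed
  show ?thesis
  proof (rule field_le_epsilon)
    fix \<epsilon> :: real assume \<epsilon>: "\<epsilon> > 0"
    \<comment> \<open>\<open>M + 1\<close> because \<open>M\<close> may be 0\<close>
    then have "\<epsilon> / (M + 1) > 0" using bound_nonneg by simp
    then obtain w where w: "w \<in> displacement_span" "w \<in> carrier E" "vnorm E (z \<ominus>\<^bsub>E\<^esub> w) < \<epsilon> / (M + 1)"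
      using z unfolding range_part_def in_closed_span_iff by blast
    have eq: "y \<oplus>\<^bsub>E\<^esub> w = (y \<oplus>\<^bsub>E\<^esub> z) \<oplus>\<^bsub>E\<^esub> (w \<ominus>\<^bsub>E\<^esub> z)"
      using y' z' w add_diff_cancel[of z w] by (simp add: M.a_assoc)
    have "vnorm E y \<le> M * vnorm E (y \<oplus>\<^bsub>E\<^esub> w)" by (rule le[OF w(1)])
    also have "\<dots> \<le> M * (vnorm E (y \<oplus>\<^bsub>E\<^esub> z) + vnorm E (w \<ominus>\<^bsub>E\<^esub> z))"
      unfolding eq using y' z' w bound_nonneg by (intro mult_left_mono norm_triangle) auto
    also have "\<dots> \<le> M * vnorm E (y \<oplus>\<^bsub>E\<^esub> z) + M * (\<epsilon> / (M + 1))"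
      using mult_left_mono[OF less_imp_le[OF w(3)] bound_nonneg] w(2) z' norm_diff_commute[of w z]
      by (simp add: distrib_left)
    also have "\<dots> \<le> M * vnorm E (y \<oplus>\<^bsub>E\<^esub> z) + \<epsilon>"
      using bound_nonneg \<epsilon> by (simp add: pos_divide_le_eq algebra_simps)
    finally show "vnorm E y \<le> M * vnorm E (y \<oplus>\<^bsub>E\<^esub> z) + \<epsilon>" .
  qed
qed

lemma null_projection_eq:
  assumes disjoint: "null_part E \<Phi> \<inter> range_part E \<Phi> = {\<zero>\<^bsub>E\<^esub>}"
    and y: "y \<in> null_part E \<Phi>" and z: "z \<in> range_part E \<Phi>"
  shows "null_projection E \<Phi> (y \<oplus>\<^bsub>E\<^esub> z) = y"
  unfolding null_projection_def
proof (rule the_equality)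
  show "y \<in> null_part E \<Phi> \<and> (\<exists>z'\<in>range_part E \<Phi>. y \<oplus>\<^bsub>E\<^esub> z = y \<oplus>\<^bsub>E\<^esub> z')" using y z by blast
  fix y' assume "y' \<in> null_part E \<Phi> \<and> (\<exists>z'\<in>range_part E \<Phi>. y \<oplus>\<^bsub>E\<^esub> z = y' \<oplus>\<^bsub>E\<^esub> z')"
  then obtain z' where y': "y' \<in> null_part E \<Phi>" and z': "z' \<in> range_part E \<Phi>"
    and eq: "y \<oplus>\<^bsub>E\<^esub> z = y' \<oplus>\<^bsub>E\<^esub> z'" by blast
  note N = submoduleE[OF submodule_null_part] and R = submoduleE[OF submodule_range_part]
  have car: "y \<in> carrier E" "y' \<in> carrier E" "z \<in> carrier E" "z' \<in> carrier E"
    using y y' z z' N(1) R(1) by auto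
  have "(y' \<ominus>\<^bsub>E\<^esub> y) \<oplus>\<^bsub>E\<^esub> (z' \<ominus>\<^bsub>E\<^esub> z) = \<zero>\<^bsub>E\<^esub>"
  proof -
    have "(y' \<ominus>\<^bsub>E\<^esub> y) \<oplus>\<^bsub>E\<^esub> (z' \<ominus>\<^bsub>E\<^esub> z) = (y' \<oplus>\<^bsub>E\<^esub> z') \<ominus>\<^bsub>E\<^esub> (y \<oplus>\<^bsub>E\<^esub> z)"
      using car by (simp add: diff_add_add)
    also have "\<dots> = \<zero>\<^bsub>E\<^esub>" using car eq by (simp add: diff_eq_zero)
    finally show ?thesis .
  qed
  \<comment> \<open>a difference of the two representations lies in both subspaces\<close>
  then have "y' \<ominus>\<^bsub>E\<^esub> y = \<ominus>\<^bsub>E\<^esub> (z' \<ominus>\<^bsub>E\<^esub> z)" using car by (metis M.minus_equality diff_closed)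
  then have "y' \<ominus>\<^bsub>E\<^esub> y \<in> range_part E \<Phi>"
    using R(3,5) z z' by (simp add: M.minus_eq)
  moreover have "y' \<ominus>\<^bsub>E\<^esub> y \<in> null_part E \<Phi>" using N(3,5) y y' by (simp add: M.minus_eq)
  ultimately have "y' \<ominus>\<^bsub>E\<^esub> y = \<zero>\<^bsub>E\<^esub>" using disjoint by blast
  then show "y' = y" using car by (simp add: diff_eq_zero)
qed

lemma closedin_null_part: "closedin (norm_topology E) (null_part E \<Phi>)"
  unfolding norm_topology_eq metric.metric_closedin_iff_sequentially_closed
proof (intro conjI allI impI)
  show "null_part E \<Phi> \<subseteq> carrier E" by (auto simp: null_part_iff)
  fix f y assume *: "range f \<subseteq> null_part E \<Phi> \<and> limitin metric.mtopology f y sequentially"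
  then have "f n \<in> null_part E \<Phi>" for n by blast
  then have f: "f n \<in> carrier E" "\<Phi> s (f n) = f n" for n s by (auto simp: null_part_iff)
  have y: "y \<in> carrier E"
    and lim: "\<And>\<epsilon>. \<epsilon> > 0 \<Longrightarrow> \<exists>N. \<forall>n\<ge>N. f n \<in> carrier E \<and> vnorm E (f n \<ominus>\<^bsub>E\<^esub> y) < \<epsilon>"
    using * by (auto simp: limit_norm_topology_iff[unfolded norm_topology_eq])
  have "\<Phi> s y = y" for s
  proof -
    have "vnorm E (\<Phi> s y \<ominus>\<^bsub>E\<^esub> y) \<le> 0"
    proof (rule field_le_epsilon)
      fix \<epsilon> :: real assume \<epsilon>: "\<epsilon> > 0"
      then have "\<epsilon> / (M + 1) > 0" using bound_nonneg by simp
      then obtain n where n: "vnorm E (f n \<ominus>\<^bsub>E\<^esub> y) < \<epsilon> / (M + 1)" using lim by blast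
      have "\<Phi> s y \<ominus>\<^bsub>E\<^esub> y = \<Phi> s (y \<ominus>\<^bsub>E\<^esub> f n) \<oplus>\<^bsub>E\<^esub> (f n \<ominus>\<^bsub>E\<^esub> y)"
        using y f diff_telescope[of "\<Phi> s y" "f n" y] by (simp add: rep_diff)
      then have "vnorm E (\<Phi> s y \<ominus>\<^bsub>E\<^esub> y) \<le> vnorm E (\<Phi> s (y \<ominus>\<^bsub>E\<^esub> f n)) + vnorm E (f n \<ominus>\<^bsub>E\<^esub> y)"
        using norm_triangle[of "\<Phi> s (y \<ominus>\<^bsub>E\<^esub> f n)" "f n \<ominus>\<^bsub>E\<^esub> y"] y f by simp
      also have "\<dots> \<le> M * vnorm E (f n \<ominus>\<^bsub>E\<^esub> y) + vnorm E (f n \<ominus>\<^bsub>E\<^esub> y)"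
        using bound[of "y \<ominus>\<^bsub>E\<^esub> f n" s] y f norm_diff_commute[of y "f n"] by simp
      also have "\<dots> = (M + 1) * vnorm E (f n \<ominus>\<^bsub>E\<^esub> y)" by (simp add: distrib_right)
      also have "\<dots> \<le> \<epsilon>" using n bound_nonneg by (simp add: pos_less_divide_eq mult.commute)
      finally show "vnorm E (\<Phi> s y \<ominus>\<^bsub>E\<^esub> y) \<le> 0 + \<epsilon>" by simp
    qed
    then have "vnorm E (\<Phi> s y \<ominus>\<^bsub>E\<^esub> y) = 0" using norm_nonneg[of "\<Phi> s y \<ominus>\<^bsub>E\<^esub> y"] y by simp
    then show ?thesis using y by (simp add: norm_eq_zero diff_eq_zero)
  qed
  then show "y \<in> null_part E \<Phi>" using y by (simp add: null_part_iff)
qed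

lemma sum_part_iff: "x \<in> sum_part E \<Phi> \<longleftrightarrow> (\<exists>y\<in>null_part E \<Phi>. \<exists>z\<in>range_part E \<Phi>. x = y \<oplus>\<^bsub>E\<^esub> z)"
  by (auto simp: sum_part_def set_add_def')

text \<open>
  For \<open>x\<close> in the intersection, the estimate for \<open>y = x\<close>, \<open>z = - x\<close> gives \<open>x = 0\<close>. Applied to
  differences, it shows that along a Cauchy sequence of sums the fixed summands are Cauchy too; their
  limit is fixed, and the remaining summands converge within the closed span.
\<close>

lemma decomposition_of_norm_estimate:
  assumes complete: "metric.mcomplete"
    and est: "\<And>y z. y \<in> null_part E \<Phi> \<Longrightarrow> z \<in> range_part E \<Phi> \<Longrightarrow> vnorm E y \<le> M * vnorm E (y \<oplus>\<^bsub>E\<^esub> z)"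
  shows "null_part E \<Phi> \<inter> range_part E \<Phi> = {\<zero>\<^bsub>E\<^esub>}" (is ?disjoint)
    and "closedin (norm_topology E) (sum_part E \<Phi>)" (is ?closed)
    and "operator_norm_on E (sum_part E \<Phi>) (null_projection E \<Phi>) \<le> ereal M" (is ?norm)
proof -
  note N = submoduleE[OF submodule_null_part] and R = submoduleE[OF submodule_range_part]
  have N0: "\<zero>\<^bsub>E\<^esub> \<in> null_part E \<Phi>" and R0: "\<zero>\<^bsub>E\<^esub> \<in> range_part E \<Phi>"
    using submodule_zero submodule_null_part submodule_range_part by auto
  show disjoint: ?disjoint
  proof -
    have "x = \<zero>\<^bsub>E\<^esub>" if x: "x \<in> null_part E \<Phi>" "x \<in> range_part E \<Phi>" for x
    proof -
      have "vnorm E x \<le> M * vnorm E (x \<oplus>\<^bsub>E\<^esub> \<ominus>\<^bsub>E\<^esub> x)" using x R(3) by (intro est) auto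
      then have "vnorm E x \<le> 0" using x N(1) by (simp add: M.r_neg norm_zero subset_iff)
      then show ?thesis using x N(1) norm_nonneg[of x] by (simp add: subset_iff flip: norm_eq_zero)
    qed
    then show ?thesis using N0 R0 by blast
  qed
  show ?norm
    unfolding operator_norm_on_def
  proof (rule SUP_least)
    fix x assume "x \<in> {x \<in> sum_part E \<Phi>. vnorm E x \<le> 1}"
    then obtain y z where yz: "y \<in> null_part E \<Phi>" "z \<in> range_part E \<Phi>" "x = y \<oplus>\<^bsub>E\<^esub> z" "vnorm E x \<le> 1"
      by (auto simp: sum_part_iff)
    have "vnorm E y \<le> M * vnorm E x" using est yz by simp
    also have "\<dots> \<le> M * 1" using yz(4) bound_nonneg by (rule mult_left_mono)
    finally show "ereal (vnorm E (null_projection E \<Phi> x)) \<le> ereal M"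
      using null_projection_eq[OF disjoint yz(1,2)] yz(3) by simp
  qed
  show ?closed
    unfolding norm_topology_eq metric.metric_closedin_iff_sequentially_closed
  proof (intro conjI allI impI)
    show "sum_part E \<Phi> \<subseteq> carrier E" using N(1) R(1) by (auto simp: sum_part_iff subset_iff)
    fix f x assume *: "range f \<subseteq> sum_part E \<Phi> \<and> limitin metric.mtopology f x sequentially"
    then have lim: "limitin (norm_topology E) f x sequentially" by (simp add: norm_topology_eq)
    have "\<forall>n. \<exists>y z. y \<in> null_part E \<Phi> \<and> z \<in> range_part E \<Phi> \<and> f n = y \<oplus>\<^bsub>E\<^esub> z"
      using * by (auto simp: sum_part_iff image_subset_iff)
    then obtain y z where yz: "\<And>n. y n \<in> null_part E \<Phi>" "\<And>n. z n \<in> range_part E \<Phi>"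
      "\<And>n. f n = y n \<oplus>\<^bsub>E\<^esub> z n" by metis
    have car: "\<And>n. y n \<in> carrier E" "\<And>n. z n \<in> carrier E" using yz N(1) R(1) by auto
    then have f: "f n \<in> carrier E" for n using yz(3) by simp
    have x: "x \<in> carrier E" using lim by (simp add: limit_norm_topology_iff)
    have "metric.MCauchy f"
      using metric.convergent_imp_MCauchy[of f x] f lim by (auto simp: norm_topology_eq)
    then have cauchy: "\<exists>N. \<forall>n n'. N \<le> n \<longrightarrow> N \<le> n' \<longrightarrow> vdist E (f n) (f n') < \<epsilon>" if "\<epsilon> > 0" for \<epsilon>
      using that by (auto simp: metric.MCauchy_def)
    have "metric.MCauchy y"
      unfolding metric.MCauchy_def
    proof (intro conjI allI impI)
      show "range y \<subseteq> carrier E" using car by auto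
      fix \<epsilon> :: real assume \<epsilon>: "\<epsilon> > 0"
      then have "\<epsilon> / (M + 1) > 0" using bound_nonneg by simp
      from cauchy[OF this] obtain N where N': "\<forall>n n'. N \<le> n \<longrightarrow> N \<le> n' \<longrightarrow> vdist E (f n) (f n') < \<epsilon> / (M + 1)" by blast
      have "vdist E (y n) (y n') < \<epsilon>" if n: "N \<le> n" "N \<le> n'" for n n'
      proof -
        have eq: "f n \<ominus>\<^bsub>E\<^esub> f n' = (y n \<ominus>\<^bsub>E\<^esub> y n') \<oplus>\<^bsub>E\<^esub> (z n \<ominus>\<^bsub>E\<^esub> z n')"
          using car yz(3) by (simp add: diff_add_add)
        have "vnorm E (y n \<ominus>\<^bsub>E\<^esub> y n') \<le> M * vnorm E (f n \<ominus>\<^bsub>E\<^esub> f n')"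
          unfolding eq using yz(1,2) N(3,5) R(3,5) by (intro est) (simp_all add: M.minus_eq)
        also have "\<dots> \<le> (M + 1) * vnorm E (f n \<ominus>\<^bsub>E\<^esub> f n')"
          using f by (intro mult_right_mono norm_nonneg) auto
        also have "\<dots> < \<epsilon>"
          using N'[rule_format, OF n] f bound_nonneg by (simp add: vdist_eq pos_less_divide_eq mult.commute)
        finally show ?thesis using car by (simp add: vdist_eq)
      qed
      then show "\<exists>N. \<forall>n n'. N \<le> n \<longrightarrow> N \<le> n' \<longrightarrow> vdist E (y n) (y n') < \<epsilon>" by blast
    qed
    then obtain y0 where lim_y: "limitin metric.mtopology y y0 sequentially"
      using complete by (auto simp: metric.mcomplete_def)
    have y0: "y0 \<in> null_part E \<Phi>"
      using closedin_null_part yz(1) lim_y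
      unfolding norm_topology_eq metric.metric_closedin_iff_sequentially_closed by blast
    have y0': "y0 \<in> carrier E" using y0 N(1) by auto
    have "limitin (norm_topology E) z (x \<ominus>\<^bsub>E\<^esub> y0) sequentially"
      unfolding limit_norm_topology_iff
    proof (intro conjI allI impI)
      show "x \<ominus>\<^bsub>E\<^esub> y0 \<in> carrier E" using x y0' by simp
      fix \<epsilon> :: real assume \<epsilon>: "\<epsilon> > 0"
      obtain N1 where N1: "\<forall>n\<ge>N1. f n \<in> carrier E \<and> vnorm E (f n \<ominus>\<^bsub>E\<^esub> x) < \<epsilon> / 2"
        using lim \<epsilon> half_gt_zero[OF \<epsilon>] unfolding limit_norm_topology_iff by blast
      obtain N2 where N2: "\<forall>n\<ge>N2. y n \<in> carrier E \<and> vnorm E (y n \<ominus>\<^bsub>E\<^esub> y0) < \<epsilon> / 2"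
        using lim_y half_gt_zero[OF \<epsilon>] unfolding norm_topology_eq[symmetric] limit_norm_topology_iff by blast
      have "vnorm E (z n \<ominus>\<^bsub>E\<^esub> (x \<ominus>\<^bsub>E\<^esub> y0)) < \<epsilon>" if "n \<ge> max N1 N2" for n
      proof -
        have "z n = f n \<ominus>\<^bsub>E\<^esub> y n" using yz(3) car by (simp add: add_diff_cancel_left)
        then have "z n \<ominus>\<^bsub>E\<^esub> (x \<ominus>\<^bsub>E\<^esub> y0) = (f n \<ominus>\<^bsub>E\<^esub> x) \<oplus>\<^bsub>E\<^esub> (y0 \<ominus>\<^bsub>E\<^esub> y n)"
          using f x y0' car by (simp add: M.minus_eq M.minus_add M.a_ac)
        then have "vnorm E (z n \<ominus>\<^bsub>E\<^esub> (x \<ominus>\<^bsub>E\<^esub> y0)) \<le> vnorm E (f n \<ominus>\<^bsub>E\<^esub> x) + vnorm E (y0 \<ominus>\<^bsub>E\<^esub> y n)"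
          using norm_triangle[of "f n \<ominus>\<^bsub>E\<^esub> x" "y0 \<ominus>\<^bsub>E\<^esub> y n"] f x y0' car by simp
        also have "\<dots> < \<epsilon> / 2 + \<epsilon> / 2"
          using N1 N2 that norm_diff_commute[of y0 "y n"] y0' car by (intro add_strict_mono) auto
        finally show ?thesis by simp
      qed
      then show "\<exists>N. \<forall>n\<ge>N. z n \<in> carrier E \<and> vnorm E (z n \<ominus>\<^bsub>E\<^esub> (x \<ominus>\<^bsub>E\<^esub> y0)) < \<epsilon>"
        using car by blast
    qed
    moreover have "closedin (norm_topology E) (range_part E \<Phi>)"
      unfolding range_part_def by (rule closedin_closed_span)
    ultimately have "x \<ominus>\<^bsub>E\<^esub> y0 \<in> range_part E \<Phi>"
      using yz(2) unfolding norm_topology_eq metric.metric_closedin_iff_sequentially_closed by blast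
    then show "x \<in> sum_part E \<Phi>"
      using y0 add_diff_cancel[OF y0' x] unfolding sum_part_iff by metis
  qed
qed

text \<open>
  The converse of the preceding lemma: normalise \<open>y + z\<close> and apply the bound on the projection.
\<close>

lemma norm_estimate_of_decomposition:
  assumes disjoint: "null_part E \<Phi> \<inter> range_part E \<Phi> = {\<zero>\<^bsub>E\<^esub>}"
    and norm: "operator_norm_on E (sum_part E \<Phi>) (null_projection E \<Phi>) \<le> ereal C"
    and y: "y \<in> null_part E \<Phi>" and z: "z \<in> range_part E \<Phi>"
  shows "vnorm E y \<le> C * vnorm E (y \<oplus>\<^bsub>E\<^esub> z)"
proof -
  note N = submoduleE[OF submodule_null_part] and R = submoduleE[OF submodule_range_part]
  have car: "y \<in> carrier E" "z \<in> carrier E" using y z N(1) R(1) by auto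
  define x where "x = y \<oplus>\<^bsub>E\<^esub> z"
  have x: "x \<in> carrier E" using car by (simp add: x_def)
  show ?thesis
  proof (cases "x = \<zero>\<^bsub>E\<^esub>")
    case True
    then have "y = \<ominus>\<^bsub>E\<^esub> z" using car M.minus_equality[of y z] by (simp add: x_def)
    then have "y = \<zero>\<^bsub>E\<^esub>" using disjoint y R(3)[OF z] by blast
    then show ?thesis using True unfolding x_def[symmetric] by (simp add: norm_zero)
  next
    case False
    then have pos: "vnorm E x > 0" using norm_nonneg[OF x] norm_eq_zero[OF x] by simp
    define c :: 'k where "c = of_real (inverse (vnorm E x))"
    have c: "norm c = inverse (vnorm E x)" using pos by (simp add: c_def norm_inverse)
    have cx: "c \<odot> x = c \<odot> y \<oplus>\<^bsub>E\<^esub> c \<odot> z" using car by (simp add: x_def scale_add_right)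
    have cyz: "c \<odot> y \<in> null_part E \<Phi>" "c \<odot> z \<in> range_part E \<Phi>" using N(4) R(4) y z by auto
    have "vnorm E (c \<odot> x) \<le> 1" using x c pos by (simp add: norm_scale)
    moreover have "c \<odot> x \<in> sum_part E \<Phi>" using cx cyz by (auto simp: sum_part_iff)
    ultimately have "ereal (vnorm E (null_projection E \<Phi> (c \<odot> x))) \<le> ereal C"
      using norm unfolding operator_norm_on_def by (auto simp: SUP_le_iff)
    then have "vnorm E (c \<odot> y) \<le> C" using null_projection_eq[OF disjoint cyz] cx by simp
    then show ?thesis using car c pos by (simp add: norm_scale field_simps flip: x_def)
  qed
qed

end

lemma bounded_representation_of_finite_norm:
  fixes \<Phi> :: "'s::{semigroup_mult, topological_space} \<Rightarrow> 'x \<Rightarrow> 'x"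
  assumes E: "normed_space E" and hom: "operator_homomorphism E \<Phi>" and fin: "sup_operator_norm E \<Phi> < \<infinity>"
  obtains M where "bounded_representation E \<Phi> M" "sup_operator_norm E \<Phi> = ereal M"
proof -
  interpret normed_carrier E by unfold_locales (rule E)
  have closed: "\<Phi> s x \<in> carrier E" if "x \<in> carrier E" for s x
    using hom that by (auto simp: operator_homomorphism_def bounded_operators_def)
  have scale: "\<Phi> s (c \<odot>\<^bsub>E\<^esub> x) = c \<odot>\<^bsub>E\<^esub> \<Phi> s x" if "x \<in> carrier E" for s x c
    using hom that by (auto simp: operator_homomorphism_def bounded_operators_def)
  have le: "ereal (vnorm E (\<Phi> s x)) \<le> sup_operator_norm E \<Phi>" if "x \<in> carrier E" "vnorm E x \<le> 1" for s x
  proof -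
    have "ereal (vnorm E (\<Phi> s x)) \<le> operator_norm_on E (carrier E) (\<Phi> s)"
      unfolding operator_norm_on_def using that by (intro SUP_upper) auto
    also have "\<dots> \<le> sup_operator_norm E \<Phi>"
      unfolding sup_operator_norm_def by (intro SUP_upper) auto
    finally show ?thesis .
  qed
  have nonneg: "0 \<le> sup_operator_norm E \<Phi>"
  proof -
    have "(0::ereal) \<le> ereal (vnorm E (\<Phi> undefined \<zero>\<^bsub>E\<^esub>))" using closed by (simp add: norm_nonneg)
    also have "\<dots> \<le> sup_operator_norm E \<Phi>" by (rule le) (simp_all add: norm_zero)
    finally show ?thesis .
  qed
  then obtain M where M: "sup_operator_norm E \<Phi> = ereal M" "0 \<le> M"
    using fin by (cases "sup_operator_norm E \<Phi>") auto
  have "vnorm E (\<Phi> s x) \<le> M * vnorm E x" if x: "x \<in> carrier E" for s x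
  proof (cases "x = \<zero>\<^bsub>E\<^esub>")
    case True
    have "\<Phi> s \<zero>\<^bsub>E\<^esub> = \<zero>\<^bsub>E\<^esub>" using scale[of "\<zero>\<^bsub>E\<^esub>" s 0] closed by simp
    then show ?thesis using True by (simp add: norm_zero)
  next
    case False
    then have pos: "vnorm E x > 0" using norm_nonneg[OF x] norm_eq_zero[OF x] by simp
    define c :: 'a where "c = of_real (inverse (vnorm E x))"
    have c: "norm c = inverse (vnorm E x)" using pos by (simp add: c_def norm_inverse)
    have "vnorm E (\<Phi> s (c \<odot>\<^bsub>E\<^esub> x)) \<le> M"
      using le[of "c \<odot>\<^bsub>E\<^esub> x" s] x c pos M by (simp add: norm_scale)
    then show ?thesis using x closed c pos by (simp add: scale norm_scale field_simps)
  qed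
  then have "bounded_representation E \<Phi> M"
    using hom M by unfold_locales
  then show thesis using M that by blast
qed

text \<open>
  Membership of the orbit functions in \<open>F\<close> is the only place where continuity of \<open>\<Phi>\<close> enters, hence
  this form, common to the two operator topologies.
\<close>

theorem decomposition_of_invariant_mean:
  fixes \<Phi> :: "'s::{semigroup_mult, topological_space} \<Rightarrow> 'x \<Rightarrow> 'x"
  assumes E: "banach_space E" and hom: "operator_homomorphism E \<Phi>" and fin: "sup_operator_norm E \<Phi> < \<infinity>"
    and mean: "right_invariant_mean_on F \<phi>"
    and orbit_mem: "\<And>M u x. bounded_representation E \<Phi> M \<Longrightarrow> u \<in> dual (underlying_real E) \<Longrightarrow>
      x \<in> carrier E \<Longrightarrow> bounded_representation.orbit \<Phi> u x \<in> F"
  shows "null_part E \<Phi> \<inter> range_part E \<Phi> = {\<zero>\<^bsub>E\<^esub>} \<and> closedin (norm_topology E) (sum_part E \<Phi>) \<and>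
    operator_norm_on E (sum_part E \<Phi>) (null_projection E \<Phi>) \<le> sup_operator_norm E \<Phi>"
proof -
  obtain M where M: "bounded_representation E \<Phi> M" "sup_operator_norm E \<Phi> = ereal M"
    using bounded_representation_of_finite_norm E hom fin unfolding banach_space_def by blast
  interpret bounded_representation E \<Phi> M by (rule M(1))
  have "vnorm E y \<le> M * vnorm E (y \<oplus>\<^bsub>E\<^esub> z)" if "y \<in> null_part E \<Phi>" "z \<in> range_part E \<Phi>" for y z
    by (rule norm_null_le_of_invariant_mean[OF mean _ that]) (rule orbit_mem[OF M(1)])
  moreover have "metric.mcomplete" using E by (simp add: banach_space_def)
  ultimately show ?thesis using decomposition_of_norm_estimate M(2) by simp
qed

lemma pointwise_continuous_of_sot:
  assumes "continuous_map euclidean (sot E) \<Phi>" "x \<in> carrier E"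
  shows "continuous_map euclidean (norm_topology E) (\<lambda>s. \<Phi> s x)"
  using assms by (auto simp: sot_def continuous_map_in_subtopology continuous_map_componentwise)

lemma pointwise_continuous_of_wot:
  assumes "continuous_map euclidean (wot E) \<Phi>" "x \<in> carrier E"
  shows "continuous_map euclidean (weak_topology E) (\<lambda>s. \<Phi> s x)"
  using assms by (auto simp: wot_def continuous_map_in_subtopology continuous_map_componentwise)

proposition sot_decomposition_of_weakly_right_amenable:
  assumes "weakly_right_amenable TYPE('s::{semigroup_mult, topological_space})"
  shows "decomposition_property sot TYPE('k::real_normed_field) TYPE('x) TYPE('s)"
proof -
  obtain \<phi> where \<phi>: "right_invariant_mean_on (C_norm :: ('s \<Rightarrow> real) set) \<phi>"
    using assms by (auto simp: weakly_right_amenable_def)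
  show ?thesis
    unfolding decomposition_property_def
  proof (intro allI impI, elim conjE)
    fix E :: "('k, 'x) nvs" and \<Phi> :: "'s \<Rightarrow> 'x \<Rightarrow> 'x"
    assume *: "banach_space E" "operator_homomorphism E \<Phi>" "continuous_map euclidean (sot E) \<Phi>"
      "sup_operator_norm E \<Phi> < \<infinity>"
    show "null_part E \<Phi> \<inter> range_part E \<Phi> = {\<zero>\<^bsub>E\<^esub>} \<and> closedin (norm_topology E) (sum_part E \<Phi>) \<and>
        operator_norm_on E (sum_part E \<Phi>) (null_projection E \<Phi>) \<le> sup_operator_norm E \<Phi>"
      using *(1,2,4) \<phi>
      by (rule decomposition_of_invariant_mean)
        (rule bounded_representation.orbit_in_C_norm[OF _ _ pointwise_continuous_of_sot[OF *(3)]])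
  qed
qed

proposition wot_decomposition_of_strongly_right_amenable:
  assumes amenable: "strongly_right_amenable TYPE('s::{semigroup_mult, topological_space})"
    and cont: "\<And>(E :: ('k::real_normed_field, 'x) nvs) u. normed_space E \<Longrightarrow> u \<in> dual (underlying_real E) \<Longrightarrow>
      continuous_map (weak_topology E) euclideanreal u"
  shows "decomposition_property wot TYPE('k) TYPE('x) TYPE('s)"
proof -
  obtain \<phi> where \<phi>: "right_invariant_mean_on (C_weak :: ('s \<Rightarrow> real) set) \<phi>"
    using amenable by (auto simp: strongly_right_amenable_def)
  show ?thesis
    unfolding decomposition_property_def
  proof (intro allI impI, elim conjE)
    fix E :: "('k, 'x) nvs" and \<Phi> :: "'s \<Rightarrow> 'x \<Rightarrow> 'x"
    assume *: "banach_space E" "operator_homomorphism E \<Phi>" "continuous_map euclidean (wot E) \<Phi>"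
      "sup_operator_norm E \<Phi> < \<infinity>"
    have "continuous_on UNIV (\<lambda>s. v (\<Phi> s x))" if "v \<in> dual (underlying_real E)" "x \<in> carrier E" for v x
      using continuous_map_compose[OF pointwise_continuous_of_wot[OF *(3) that(2)] cont[OF _ that(1)]] *(1)
      by (simp add: banach_space_def o_def)
    then have "bounded_representation.orbit \<Phi> u x \<in> C_weak"
      if "bounded_representation E \<Phi> M" "u \<in> dual (underlying_real E)" "x \<in> carrier E" for M u x
      using bounded_representation.orbit_in_C_weak[OF that(1,2) _ that(3)] by blast
    then show "null_part E \<Phi> \<inter> range_part E \<Phi> = {\<zero>\<^bsub>E\<^esub>} \<and> closedin (norm_topology E) (sum_part E \<Phi>) \<and>
        operator_norm_on E (sum_part E \<Phi>) (null_projection E \<Phi>) \<le> sup_operator_norm E \<Phi>"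
      using decomposition_of_invariant_mean[OF *(1,2,4) \<phi>] by blast
  qed
qed

section \<open>From the decomposition to an invariant mean\<close>

locale translation_space_copy = bounded_function_space_copy F e d
  for F :: "('s::{semigroup_mult, topological_space} \<Rightarrow> real) set"
    and e :: "('s \<Rightarrow> real) \<Rightarrow> 'x" and d :: "'x \<Rightarrow> 's \<Rightarrow> real" +
  assumes one_mem: "(\<lambda>_. 1) \<in> F"
    and translate_mem: "\<And>f s. f \<in> F \<Longrightarrow> translate f s \<in> F"
begin

definition right_translation :: "'s \<Rightarrow> 'x \<Rightarrow> 'x" where
  "right_translation s = (\<lambda>v\<in>e ` F. e (translate (d v) s))"

lemma right_translation_encode [simp]: "f \<in> F \<Longrightarrow> right_translation s (e f) = e (translate f s)"
  by (simp add: right_translation_def)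

lemma norm_right_translation_le: "f \<in> F \<Longrightarrow> vnorm Y (e (translate f s)) \<le> vnorm Y (e f)"
  by (intro norm_copy_le) (simp only: translate_def abs_le_norm_copy)

lemma right_translation_bounded: "right_translation s \<in> bounded_operators Y"
  unfolding bounded_operators_def mem_Collect_eq
proof (intro conjI ballI allI exI)
  show "right_translation s \<in> carrier Y \<rightarrow>\<^sub>E carrier Y"
    by (auto simp: right_translation_def translate_mem)
next
  fix v assume "v \<in> carrier Y"
  then show "vnorm Y (right_translation s v) \<le> 1 * vnorm Y v"
    using norm_right_translation_le by auto
qed (auto simp: add_mem scale_mem translate_def)

lemma operator_homomorphism_right_translation: "operator_homomorphism Y right_translation"
  unfolding operator_homomorphism_def
proof (intro conjI allI right_translation_bounded)
  fix s t
  show "right_translation (s * t) = compose (carrier Y) (right_translation s) (right_translation t)"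
  proof (rule extensionalityI[of _ "e ` F"])
    fix v assume "v \<in> e ` F"
    then show "right_translation (s * t) v = compose (carrier Y) (right_translation s) (right_translation t) v"
      by (auto simp: compose_def translate_mem) (simp add: translate_def mult.assoc)
  qed (simp_all add: right_translation_def compose_def)
qed

end

sublocale translation_space_copy \<subseteq> shifts: bounded_representation Y right_translation 1
proof
  show "vnorm Y (right_translation s x) \<le> 1 * vnorm Y x" if "x \<in> carrier Y" for s x
    using that norm_right_translation_le by auto
qed (simp_all add: operator_homomorphism_right_translation)

context translation_space_copy
begin

lemma sup_operator_norm_right_translation: "sup_operator_norm Y right_translation \<le> ereal 1"
  unfolding sup_operator_norm_def operator_norm_on_def
proof (intro SUP_least)
  fix s v assume "v \<in> {v \<in> carrier Y. vnorm Y v \<le> 1}"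
  then show "ereal (vnorm Y (right_translation s v)) \<le> ereal 1"
    using shifts.bound[of v s] by simp
qed

text \<open>
  If \<open>z\<close> were below some \<open>- \<delta> < 0\<close> everywhere, then \<open>1 + z / K\<close> would have norm at most
  \<open>1 - \<delta> / K < 1\<close>, where \<open>K \<ge> \<parallel>z\<parallel>\<close> keeps it nonnegative. But the constant 1 is fixed by translations
  and has norm at most \<open>\<parallel>1 + z / K\<parallel>\<close>.
\<close>

lemma Sup_nonneg_of_decomposition:
  assumes disjoint: "null_part Y right_translation \<inter> range_part Y right_translation = {\<zero>\<^bsub>Y\<^esub>}"
    and norm: "operator_norm_on Y (sum_part Y right_translation) (null_projection Y right_translation)
      \<le> sup_operator_norm Y right_translation"
    and z: "z \<in> range_part Y right_translation"
  shows "0 \<le> (SUP t. d z t)"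
proof (rule ccontr)
  assume neg: "\<not> ?thesis"
  obtain g where g: "g \<in> F" "z = e g"
    using z copy.submoduleE(1)[OF shifts.submodule_range_part] by auto
  define \<delta> where "\<delta> = - (SUP t. g t)"
  have \<delta>: "\<delta> > 0" using neg g(2) by (simp add: \<delta>_def)
  have bdd: "bdd_above (range g)" using bounded_mem[OF g(1)] by (rule bounded_imp_bdd_above)
  have upper: "g t \<le> - \<delta>" for t using cSUP_upper[OF UNIV_I bdd, of t] by (simp add: \<delta>_def)
  \<comment> \<open>the summand 1 spares a proof that \<open>z\<close> is not 0\<close>
  define K where "K = vnorm Y z + 1"
  have lower: "\<bar>g t\<bar> \<le> K" for t using abs_le_norm_copy[OF g(1), of t] g(2) by (simp add: K_def)
  have K: "K > 0" using copy.norm_nonneg[of z] g by (simp add: K_def)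
  have "vnorm Y (e (\<lambda>_. 1)) \<le> 1 * vnorm Y (e (\<lambda>_. 1) \<oplus>\<^bsub>Y\<^esub> (1 / K) \<odot>\<^bsub>Y\<^esub> z)"
  proof (rule shifts.norm_estimate_of_decomposition[OF disjoint])
    show "operator_norm_on Y (sum_part Y right_translation) (null_projection Y right_translation) \<le> ereal 1"
      using norm sup_operator_norm_right_translation by (rule order_trans)
    show "e (\<lambda>_. 1) \<in> null_part Y right_translation"
      using one_mem by (simp add: shifts.null_part_iff translate_def)
    show "(1 / K) \<odot>\<^bsub>Y\<^esub> z \<in> range_part Y right_translation"
      using copy.submoduleE(4)[OF shifts.submodule_range_part, of "1 / K" z] z by simp
  qed
  also have "\<dots> \<le> 1 - \<delta> / K"
  proof -
    have "\<bar>1 + 1 / K * g t\<bar> \<le> 1 - \<delta> / K" for t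
    proof -
      have "- 1 \<le> 1 / K * g t" "1 / K * g t \<le> - (\<delta> / K)" "\<delta> / K \<le> 1"
        using upper[of t] lower[of t] K by (simp_all add: field_simps)
      then show ?thesis by linarith
    qed
    then have "vnorm Y (e (\<lambda>t. 1 + 1 / K * g t)) \<le> 1 - \<delta> / K" by (rule norm_copy_le)
    then show ?thesis using g(2) by simp
  qed
  finally show False using \<delta> K by (simp add: divide_le_0_iff)
qed

text \<open>
  Mazur-Orlicz for \<open>sup\<close> and the cone \<open>W \<times> {0}\<close>, with \<open>W\<close> the span of the displacements.
  As \<open>W\<close> is a subspace, the functional obtained vanishes on it, which is invariance; being dominated
  by \<open>sup\<close> is being a mean.
\<close>

theorem invariant_mean_of_decomposition:
  assumes disjoint: "null_part Y right_translation \<inter> range_part Y right_translation = {\<zero>\<^bsub>Y\<^esub>}"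
    and norm: "operator_norm_on Y (sum_part Y right_translation) (null_projection Y right_translation)
      \<le> sup_operator_norm Y right_translation"
  shows "\<exists>\<phi>. right_invariant_mean_on F \<phi>"
proof -
  interpret real: real_vector_space_on Y
    using copy.real_vector_space_on_underlying_real by simp
  have bdd: "bdd_above (range f)" if "f \<in> F" for f
    using bounded_mem[OF that] by (rule bounded_imp_bdd_above)
  define p where "p v = (SUP t. d v t)" for v
  have p: "sublinear_on Y p"
    unfolding sublinear_on_def
  proof (intro conjI ballI allI impI)
    fix x y assume "x \<in> carrier Y" "y \<in> carrier Y"
    then obtain f g where fg: "f \<in> F" "g \<in> F" "x = e f" "y = e g" by auto
    have "(SUP t. f t + g t) \<le> (SUP t. f t) + (SUP t. g t)"
      using fg bdd by (intro cSUP_least add_mono cSUP_upper) auto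
    then show "p (x \<oplus>\<^bsub>Y\<^esub> y) \<le> p x + p y" using fg by (simp add: p_def)
  next
    fix x and c :: real assume "x \<in> carrier Y" "c > 0"
    then obtain f where f: "f \<in> F" "x = e f" by auto
    have "(SUP t. c * f t) \<le> c * (SUP t. f t)"
      using f bdd \<open>c > 0\<close> by (intro cSUP_least mult_left_mono cSUP_upper) auto
    then show "p (c \<odot>\<^bsub>Y\<^esub> x) \<le> c * p x" using f by (simp add: p_def)
  qed
  let ?D = shifts.displacement_span
  note D = copy.submoduleE[OF shifts.submodule_displacement_span]
  have D0: "\<zero>\<^bsub>Y\<^esub> \<in> ?D" by (rule copy.submodule_zero[OF shifts.submodule_displacement_span])
  have D_range: "?D \<subseteq> range_part Y right_translation"
    unfolding range_part_def by (rule copy.hull_subset_closed_span[OF shifts.displacements_subset])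
  obtain u where u: "linear_on_carrier Y u" "\<And>x. x \<in> carrier Y \<Longrightarrow> u x \<le> p x"
    "\<And>w a. (w, a) \<in> ?D \<times> {0} \<Longrightarrow> a \<le> u w"
  proof (rule real.mazur_orlicz[OF p, of "?D \<times> {0}"], goal_cases)
    case (5 w a)
    then show ?case using Sup_nonneg_of_decomposition[OF disjoint norm] D_range by (auto simp: p_def)
  qed (use D D0 in \<open>auto simp del: function_space_copy_simps\<close>)
  have u_add: "u (x \<oplus>\<^bsub>Y\<^esub> y) = u x + u y" if "x \<in> carrier Y" "y \<in> carrier Y" for x y
    using u(1) that unfolding linear_on_carrier_def by blast
  have u_scale: "u (c \<odot>\<^bsub>Y\<^esub> x) = c * u x" if "x \<in> carrier Y" for x c
    using u(1) that unfolding linear_on_carrier_def by blast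
  have u_D: "u w = 0" if w: "w \<in> ?D" for w
  proof (rule antisym)
    have "0 \<le> u (\<ominus>\<^bsub>Y\<^esub> w)" using u(3) D(3)[OF w] by blast
    also have "\<dots> = - u w"
      using u_scale[of w "- 1"] copy.scale_minus_one[of w] D(1) w by auto
    finally show "u w \<le> 0" by simp
    show "0 \<le> u w" using u(3) w by blast
  qed
  define \<phi> where "\<phi> f = u (e f)" for f
  have add: "\<phi> (\<lambda>t. f t + g t) = \<phi> f + \<phi> g" if "f \<in> F" "g \<in> F" for f g
    using u_add[of "e f" "e g"] that by (simp add: \<phi>_def)
  have scale: "\<phi> (\<lambda>t. c * f t) = c * \<phi> f" if "f \<in> F" for f c
    using u_scale[of "e f" c] that by (simp add: \<phi>_def)
  have le: "\<phi> f \<le> (SUP t. f t)" if "f \<in> F" for f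
    using u(2)[of "e f"] that by (simp add: \<phi>_def p_def)
  have ge: "(INF t. f t) \<le> \<phi> f" if f: "f \<in> F" for f
  proof -
    have "bdd_below (range f)" using bounded_mem[OF f] by (rule bounded_imp_bdd_below)
    then have "(SUP t. - f t) \<le> - (INF t. f t)" by (intro cSUP_least) (auto intro: cINF_lower)
    then show ?thesis using le[OF uminus_mem[OF f]] scale[OF f, of "- 1"] by simp
  qed
  have "\<phi> (translate f s) = \<phi> f" if f: "f \<in> F" for f s
  proof -
    have "right_translation s (e f) \<ominus>\<^bsub>Y\<^esub> e f \<in> shifts.displacements"
      using f by (intro UN_I[of s] imageI) simp_all
    then have "u (e (translate f s) \<ominus>\<^bsub>Y\<^esub> e f) = 0"
      using f by (intro u_D hull_inc) simp
    then have "\<phi> (\<lambda>t. translate f s t + (- 1) * f t) = 0"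
      using f translate_mem[OF f] by (simp add: diff_copy \<phi>_def)
    then show ?thesis
      using add[OF translate_mem[OF f] scale_mem[OF f, of "- 1"], of s] scale[OF f, of "- 1"] by simp
  qed
  then have "right_invariant_mean_on F \<phi>"
    using add scale le ge by (simp add: right_invariant_mean_on_def mean_on_def)
  then show ?thesis by blast
qed

end

section \<open>The two function spaces\<close>

lemma continuous_on_uniform_approximation:
  fixes g :: "'a::topological_space \<Rightarrow> real"
  assumes "\<And>\<epsilon>. \<epsilon> > 0 \<Longrightarrow> \<exists>h. continuous_on UNIV h \<and> (\<forall>s. \<bar>h s - g s\<bar> \<le> \<epsilon>)"
  shows "continuous_on UNIV g"
proof -
  have "\<forall>n. \<exists>h. continuous_on UNIV h \<and> (\<forall>s. \<bar>h s - g s\<bar> \<le> 1 / real (Suc n))"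
    using assms by simp
  then obtain h where h: "\<And>n. continuous_on UNIV (h n)" "\<And>n s. \<bar>h n s - g s\<bar> \<le> 1 / real (Suc n)"
    by metis
  have "uniform_limit UNIV h g sequentially"
  proof (rule uniform_limitI)
    fix \<epsilon> :: real assume "\<epsilon> > 0"
    then have "\<forall>\<^sub>F n in sequentially. 1 / real (Suc n) < \<epsilon>"
      using order_tendstoD(2)[OF LIMSEQ_inverse_real_of_nat] by (simp add: inverse_eq_divide)
    then show "\<forall>\<^sub>F n in sequentially. \<forall>s\<in>UNIV. dist (h n s) (g s) < \<epsilon>"
      by (rule eventually_mono) (auto simp: dist_real_def intro: le_less_trans[OF h(2)])
  qed
  then show ?thesis using h(1) by (intro uniform_limit_theorem[of _ h]) auto
qed

lemma C_r_uniform_limit: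
  assumes approx: "\<And>\<epsilon>. \<epsilon> > 0 \<Longrightarrow> \<exists>h\<in>C_r. \<forall>t. \<bar>h t - f t\<bar> \<le> \<epsilon>"
  shows "f \<in> C_r"
proof -
  have "continuous_on UNIV f"
    using approx by (intro continuous_on_uniform_approximation) (fastforce simp: C_r_def bcontfun_def)
  moreover have "continuous_on UNIV (translate f s)" for s
  proof (rule continuous_on_uniform_approximation)
    fix \<epsilon> :: real assume "\<epsilon> > 0"
    then obtain h where h: "h \<in> C_r" "\<forall>t. \<bar>h t - f t\<bar> \<le> \<epsilon>" using approx by blast
    then show "\<exists>h. continuous_on UNIV h \<and> (\<forall>t. \<bar>h t - translate f s t\<bar> \<le> \<epsilon>)"
      by (intro exI[of _ "translate h s"]) (auto simp: C_r_def translate_def)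
  qed
  moreover have "bounded (range f)"
  proof -
    obtain h where h: "h \<in> C_r" "\<forall>t. \<bar>h t - f t\<bar> \<le> 1" using approx[of 1] by auto
    then obtain B where B: "\<forall>t. \<bar>h t\<bar> \<le> B" by (auto simp: C_r_def bcontfun_def bounded_iff)
    have "\<bar>f t\<bar> \<le> B + 1" for t using h(2)[rule_format, of t] B[rule_format, of t] by linarith
    then show ?thesis by (auto simp: bounded_iff)
  qed
  ultimately show ?thesis by (simp add: C_r_def bcontfun_def)
qed

lemma translate_translate: "translate (translate f t) = (\<lambda>s. translate f (s * t))"
  by (simp add: translate_def mult.assoc fun_eq_iff)

lemma translate_in_C_r: "f \<in> C_r \<Longrightarrow> translate f s \<in> C_r"
  by (auto simp: C_r_def bcontfun_def translate_translate)
    (auto simp: translate_def bounded_iff)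

text \<open>
  The common part of \<open>C_norm\<close> and \<open>C_weak\<close>: both consist of the functions whose translates depend
  continuously on the translating element, for a notion \<open>P\<close> of continuity that respects linear
  operations and uniform limits.
\<close>

locale orbit_continuity =
  fixes P :: "('s::{semigroup_mult, topological_space} \<Rightarrow> 's \<Rightarrow> real) \<Rightarrow> bool"
  assumes const: "\<And>f. f \<in> C_r \<Longrightarrow> P (\<lambda>_. f)"
    and add: "\<And>g h. P g \<Longrightarrow> P h \<Longrightarrow> P (\<lambda>s t. g s t + h s t)"
    and scale: "\<And>g c. P g \<Longrightarrow> P (\<lambda>s t. c * g s t)"
    and uniform_limit: "\<And>g. (\<And>s. g s \<in> C_r) \<Longrightarrow>
      (\<And>\<epsilon>. \<epsilon> > 0 \<Longrightarrow> \<exists>h. P h \<and> (\<forall>s t. \<bar>h s t - g s t\<bar> \<le> \<epsilon>)) \<Longrightarrow> P g"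
begin

definition orbit_space :: "('s \<Rightarrow> real) set" where
  "orbit_space = {f \<in> C_r. P (\<lambda>s. translate f s) \<and> (\<forall>t. P (\<lambda>s. translate f (s * t)))}"

lemma translation_space_copy_orbit_space:
  assumes de: "\<And>f. d (e f) = f"
  shows "translation_space_copy orbit_space e d"
proof
  have const_mem: "(\<lambda>_. c) \<in> orbit_space" for c
  proof -
    have "(\<lambda>_. c) \<in> (C_r :: ('s \<Rightarrow> real) set)" by (simp add: C_r_def bcontfun_def translate_def)
    then show ?thesis using const[of "\<lambda>_. c"] by (simp add: orbit_space_def translate_def)
  qed
  show "(\<lambda>_. 0) \<in> orbit_space" "(\<lambda>_. 1) \<in> orbit_space" by (rule const_mem)+
  show "(\<lambda>t. f t + g t) \<in> orbit_space" if "f \<in> orbit_space" "g \<in> orbit_space" for f g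
    using that add[of "\<lambda>s. translate f s" "\<lambda>s. translate g s"]
      add[of "\<lambda>s. translate f (s * _)" "\<lambda>s. translate g (s * _)"]
    by (simp add: orbit_space_def translate_def C_r.add_mem)
  show "(\<lambda>t. c * f t) \<in> orbit_space" if "f \<in> orbit_space" for f c
    using that scale[of "\<lambda>s. translate f s" c] scale[of "\<lambda>s. translate f (s * _)" c]
    by (simp add: orbit_space_def translate_def C_r.scale_mem)
  show "bounded (range f)" if "f \<in> orbit_space" for f
    using that by (simp add: orbit_space_def C_r.bounded_mem)
  show "translate f s \<in> orbit_space" if "f \<in> orbit_space" for f s
    using that by (simp add: orbit_space_def translate_in_C_r translate_translate mult.assoc)
  show "d (e f) = f" for f by (rule de)
qed

lemma orbit_space_uniform_limit:
  assumes approx: "\<And>\<epsilon>. \<epsilon> > 0 \<Longrightarrow> \<exists>h\<in>orbit_space. \<forall>t. \<bar>h t - f t\<bar> \<le> \<epsilon>"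
  shows "f \<in> orbit_space"
proof -
  have f: "f \<in> C_r"
  proof (rule C_r_uniform_limit)
    fix \<epsilon> :: real assume "\<epsilon> > 0"
    from approx[OF this] show "\<exists>h\<in>C_r. \<forall>t. \<bar>h t - f t\<bar> \<le> \<epsilon>" by (auto simp: orbit_space_def)
  qed
  have "P (\<lambda>s. translate f (r s))"
    if P: "\<And>h. h \<in> orbit_space \<Longrightarrow> P (\<lambda>s. translate h (r s))" for r
  proof (rule uniform_limit)
    fix \<epsilon> :: real assume "\<epsilon> > 0"
    then obtain h where "h \<in> orbit_space" "\<forall>t. \<bar>h t - f t\<bar> \<le> \<epsilon>" using approx by blast
    then show "\<exists>h. P h \<and> (\<forall>s t. \<bar>h s t - translate f (r s) t\<bar> \<le> \<epsilon>)"
      using P by (intro exI[of _ "\<lambda>s. translate h (r s)"]) (auto simp: translate_def)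
  qed (rule translate_in_C_r[OF f])
  from this[of "\<lambda>s. s"] this[of "\<lambda>s. s * _"] show ?thesis using f by (simp add: orbit_space_def)
qed

lemma banach_space_orbit_space:
  assumes de: "\<And>f. d (e f) = f"
  shows "banach_space (function_space_copy e d orbit_space)"
proof -
  interpret translation_space_copy orbit_space e d by (rule translation_space_copy_orbit_space[OF de])
  show ?thesis by (rule banach_space_copy) (rule orbit_space_uniform_limit)
qed

lemma invariant_mean_on_orbit_space:
  fixes \<tau> :: "(real, ('x, 's) universe) nvs \<Rightarrow> (('x, 's) universe \<Rightarrow> ('x, 's) universe) topology"
  assumes dec: "decomposition_property \<tau> TYPE(real) TYPE(('x, 's) universe) TYPE('s)"
    and cont: "continuous_map euclidean (\<tau> (function_space_copy Inr projr orbit_space))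
      (translation_space_copy.right_translation orbit_space Inr projr)"
  shows "\<exists>\<phi>. right_invariant_mean_on orbit_space \<phi>"
proof -
  interpret translation_space_copy orbit_space "Inr :: _ \<Rightarrow> ('x, 's) universe" projr
    by (rule translation_space_copy_orbit_space) simp
  have "banach_space Y" by (rule banach_space_orbit_space) simp
  moreover have "sup_operator_norm Y right_translation < \<infinity>"
    using sup_operator_norm_right_translation by (rule order_le_less_trans) simp
  ultimately show ?thesis
    using dec operator_homomorphism_right_translation cont
    unfolding decomposition_property_def by (intro invariant_mean_of_decomposition) blast+
qed

end

section \<open>Norm continuous orbits\<close>

definition norm_continuous :: "('s::{semigroup_mult, topological_space} \<Rightarrow> 's \<Rightarrow> real) \<Rightarrow> bool" where
  "norm_continuous g \<longleftrightarrow> continuous_map euclidean (norm_topology C_r_space) g"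

text \<open>
  The right-hand side depends neither on the encoding nor on the subspace \<open>F\<close>, so norm continuity may
  be transferred between \<open>C_r\<close> and a copy of a subspace of it.
\<close>

lemma norm_continuous_copy_iff:
  fixes g :: "'s::topological_space \<Rightarrow> 't \<Rightarrow> real"
  assumes "bounded_function_space_copy F e d" and g: "\<And>s. g s \<in> F"
  shows "continuous_map euclidean (norm_topology (function_space_copy e d F)) (\<lambda>s. e (g s)) \<longleftrightarrow>
    (\<forall>s. \<forall>\<epsilon>>0. \<exists>U. open U \<and> s \<in> U \<and> (\<forall>s'\<in>U. \<forall>t. \<bar>g s' t - g s t\<bar> \<le> \<epsilon>))"
    (is "?L \<longleftrightarrow> ?R")
proof -
  interpret bounded_function_space_copy F e d by fact
  have diff: "e (g s') \<ominus>\<^bsub>Y\<^esub> e (g s) = e (\<lambda>t. g s' t - g s t)" for s s' by (rule diff_copy[OF g g])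
  have L_iff: "?L \<longleftrightarrow> (\<forall>s. \<forall>\<epsilon>>0. \<exists>U. open U \<and> s \<in> U \<and> (\<forall>s'\<in>U. vnorm Y (e (\<lambda>t. g s' t - g s t)) < \<epsilon>))"
    unfolding copy.continuous_map_norm_topology_iff diff using g by simp
  show ?thesis
  proof
    assume ?L
    have "\<bar>g s' t - g s t\<bar> \<le> \<epsilon>" if "vnorm Y (e (\<lambda>t. g s' t - g s t)) < \<epsilon>" for s s' t \<epsilon>
      using abs_le_norm_copy[OF diff_mem[OF g[of s'] g[of s]], of t] that by linarith
    then show ?R using \<open>?L\<close> unfolding L_iff by meson
  next
    assume R: ?R
    show ?L
      unfolding L_iff
    proof (intro allI impI)
      fix s and \<epsilon> :: real assume "\<epsilon> > 0"
      then obtain U where U: "open U" "s \<in> U" "\<forall>s'\<in>U. \<forall>t. \<bar>g s' t - g s t\<bar> \<le> \<epsilon> / 2"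
        using R half_gt_zero by metis
      have "vnorm Y (e (\<lambda>t. g s' t - g s t)) < \<epsilon>" if "s' \<in> U" for s'
        using norm_copy_le[of "\<lambda>t. g s' t - g s t" "\<epsilon> / 2"] U(3) that \<open>\<epsilon> > 0\<close>
        by (simp del: function_space_copy_simps)
      then show "\<exists>U. open U \<and> s \<in> U \<and> (\<forall>s'\<in>U. vnorm Y (e (\<lambda>t. g s' t - g s t)) < \<epsilon>)"
        using U by blast
    qed
  qed
qed

lemma norm_continuous_iff:
  "norm_continuous g \<longleftrightarrow> (\<forall>s. g s \<in> C_r) \<and>
     (\<forall>s. \<forall>\<epsilon>>0. \<exists>U. open U \<and> s \<in> U \<and> (\<forall>s'\<in>U. \<forall>t. \<bar>g s' t - g s t\<bar> \<le> \<epsilon>))"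
proof (cases "\<forall>s. g s \<in> C_r")
  case True
  then show ?thesis
    using norm_continuous_copy_iff[OF C_r.bounded_function_space_copy_axioms, of g]
    by (simp add: norm_continuous_def C_r_space_eq_copy)
next
  case False
  then show ?thesis
    unfolding norm_continuous_def C_r.copy.continuous_map_norm_topology_iff by auto
qed

lemma orbit_continuity_norm:
  "orbit_continuity (norm_continuous :: ('s::{semigroup_mult, topological_space} \<Rightarrow> 's \<Rightarrow> real) \<Rightarrow> bool)"
proof
  show "norm_continuous (\<lambda>_. f)" if "f \<in> C_r" for f :: "'s \<Rightarrow> real"
    using that by (auto simp: norm_continuous_iff intro!: exI[of _ UNIV])
  show "norm_continuous (\<lambda>s t. g s t + h s t)" if g: "norm_continuous g" and h: "norm_continuous h"
    for g h :: "'s \<Rightarrow> 's \<Rightarrow> real"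
    unfolding norm_continuous_iff
  proof (intro conjI allI impI)
    show "(\<lambda>t. g s t + h s t) \<in> C_r" for s
      using g h by (simp add: norm_continuous_iff C_r.add_mem)
    fix s and \<epsilon> :: real assume "\<epsilon> > 0"
    then have \<epsilon>: "\<epsilon> / 2 > 0" by simp
    obtain U where U: "open U" "s \<in> U" "\<forall>s'\<in>U. \<forall>t. \<bar>g s' t - g s t\<bar> \<le> \<epsilon> / 2"
      using g \<epsilon> unfolding norm_continuous_iff by meson
    obtain V where V: "open V" "s \<in> V" "\<forall>s'\<in>V. \<forall>t. \<bar>h s' t - h s t\<bar> \<le> \<epsilon> / 2"
      using h \<epsilon> unfolding norm_continuous_iff by meson
    have "\<bar>g s' t + h s' t - (g s t + h s t)\<bar> \<le> \<epsilon>" if "s' \<in> U \<inter> V" for s' t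
    proof -
      have "\<bar>g s' t - g s t\<bar> \<le> \<epsilon> / 2" "\<bar>h s' t - h s t\<bar> \<le> \<epsilon> / 2" using U V that by auto
      then show ?thesis by linarith
    qed
    then show "\<exists>U. open U \<and> s \<in> U \<and> (\<forall>s'\<in>U. \<forall>t. \<bar>g s' t + h s' t - (g s t + h s t)\<bar> \<le> \<epsilon>)"
      using U V by (intro exI[of _ "U \<inter> V"]) auto
  qed
  show "norm_continuous (\<lambda>s t. c * g s t)" if g: "norm_continuous g" for g :: "'s \<Rightarrow> 's \<Rightarrow> real" and c
    unfolding norm_continuous_iff
  proof (intro conjI allI impI)
    show "(\<lambda>t. c * g s t) \<in> C_r" for s
      using g by (simp add: norm_continuous_iff C_r.scale_mem)
    fix s and \<epsilon> :: real assume "\<epsilon> > 0"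
    then have \<epsilon>: "\<epsilon> / (\<bar>c\<bar> + 1) > 0" by (simp add: add_nonneg_pos)
    obtain U where U: "open U" "s \<in> U" "\<forall>s'\<in>U. \<forall>t. \<bar>g s' t - g s t\<bar> \<le> \<epsilon> / (\<bar>c\<bar> + 1)"
      using g \<epsilon> unfolding norm_continuous_iff by meson
    have "\<bar>c * g s' t - c * g s t\<bar> \<le> \<epsilon>" if "s' \<in> U" for s' t
    proof -
      have "\<bar>c * g s' t - c * g s t\<bar> = \<bar>c\<bar> * \<bar>g s' t - g s t\<bar>"
        by (simp add: abs_mult flip: right_diff_distrib)
      also have "\<dots> \<le> (\<bar>c\<bar> + 1) * (\<epsilon> / (\<bar>c\<bar> + 1))"
        using U(3) that by (intro mult_mono) auto
      also have "\<dots> = \<epsilon>" by simp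
      finally show ?thesis .
    qed
    with U show "\<exists>U. open U \<and> s \<in> U \<and> (\<forall>s'\<in>U. \<forall>t. \<bar>c * g s' t - c * g s t\<bar> \<le> \<epsilon>)" by blast
  qed
  show "norm_continuous g"
    if mem: "\<And>s. g s \<in> C_r"
      and approx: "\<And>\<epsilon>. \<epsilon> > 0 \<Longrightarrow> \<exists>h. norm_continuous h \<and> (\<forall>s t. \<bar>h s t - g s t\<bar> \<le> \<epsilon>)"
    for g :: "'s \<Rightarrow> 's \<Rightarrow> real"
    unfolding norm_continuous_iff
  proof (intro conjI allI impI mem)
    fix s and \<epsilon> :: real assume "\<epsilon> > 0"
    then have \<epsilon>: "\<epsilon> / 3 > 0" by simp
    obtain h where h: "norm_continuous h" "\<forall>s t. \<bar>h s t - g s t\<bar> \<le> \<epsilon> / 3" using approx[OF \<epsilon>] by blast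
    obtain U where U: "open U" "s \<in> U" "\<forall>s'\<in>U. \<forall>t. \<bar>h s' t - h s t\<bar> \<le> \<epsilon> / 3"
      using h(1) \<epsilon> unfolding norm_continuous_iff by meson
    have "\<bar>g s' t - g s t\<bar> \<le> \<epsilon>" if "s' \<in> U" for s' t
    proof -
      have "\<bar>h s' t - g s' t\<bar> \<le> \<epsilon> / 3" "\<bar>h s t - g s t\<bar> \<le> \<epsilon> / 3" "\<bar>h s' t - h s t\<bar> \<le> \<epsilon> / 3"
        using h(2) U(3) that by auto
      then show ?thesis by linarith
    qed
    with U show "\<exists>U. open U \<and> s \<in> U \<and> (\<forall>s'\<in>U. \<forall>t. \<bar>g s' t - g s t\<bar> \<le> \<epsilon>)" by blast
  qed
qed

interpretation norm: orbit_continuity norm_continuous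
  by (rule orbit_continuity_norm)

lemma C_norm_eq: "C_norm = norm.orbit_space"
  by (simp add: C_norm_def norm.orbit_space_def norm_continuous_def)

proposition weakly_right_amenable_of_sot_decomposition:
  assumes "decomposition_property sot TYPE(real) TYPE(('x, 's) universe) TYPE('s::{semigroup_mult, topological_space})"
  shows "weakly_right_amenable TYPE('s)"
proof -
  interpret translation_space_copy "norm.orbit_space :: ('s \<Rightarrow> real) set" "Inr :: _ \<Rightarrow> ('x, 's) universe" projr
    by (rule norm.translation_space_copy_orbit_space) simp
  have "continuous_map euclidean (norm_topology Y) (\<lambda>s. right_translation s v)" if v: "v \<in> carrier Y" for v
  proof -
    obtain f where f: "f \<in> norm.orbit_space" "v = Inr f" using v by auto
    have "norm_continuous (\<lambda>s. translate f s)" using f(1) by (simp add: norm.orbit_space_def)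
    then have "continuous_map euclidean (norm_topology Y) (\<lambda>s. Inr (translate f s))"
      by (subst norm_continuous_copy_iff[OF bounded_function_space_copy_axioms translate_mem[OF f(1)]])
        (simp add: norm_continuous_iff)
    then show ?thesis using f by simp
  qed
  then have "continuous_map euclidean (sot Y) right_translation"
    using right_translation_bounded
    by (auto simp: sot_def continuous_map_in_subtopology continuous_map_componentwise right_translation_def)
  then have "\<exists>\<phi>. right_invariant_mean_on (norm.orbit_space :: ('s \<Rightarrow> real) set) \<phi>"
    by (rule norm.invariant_mean_on_orbit_space[OF assms])
  then show ?thesis by (simp add: weakly_right_amenable_def C_norm_eq)
qed

section \<open>Weakly continuous orbits\<close>

definition weak_continuous :: "('s::{semigroup_mult, topological_space} \<Rightarrow> 's \<Rightarrow> real) \<Rightarrow> bool" where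
  "weak_continuous g \<longleftrightarrow> continuous_map euclidean (weak_topology C_r_space) g"

lemma weak_continuous_iff:
  "weak_continuous g \<longleftrightarrow> (\<forall>s. g s \<in> C_r) \<and> (\<forall>\<psi>\<in>dual C_r_space. continuous_on UNIV (\<lambda>s. \<psi> (g s)))"
  by (simp add: weak_continuous_def continuous_map_weak_topology_iff)

lemma orbit_continuity_weak:
  "orbit_continuity (weak_continuous :: ('s::{semigroup_mult, topological_space} \<Rightarrow> 's \<Rightarrow> real) \<Rightarrow> bool)"
proof
  have dual_add: "\<psi> (\<lambda>t. f t + g t) = \<psi> f + \<psi> g" if "\<psi> \<in> dual C_r_space" "f \<in> C_r" "g \<in> C_r"
    for \<psi> and f g :: "'s \<Rightarrow> real"
    using that by (auto simp: dual_def)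
  have dual_scale: "\<psi> (\<lambda>t. c * f t) = c * \<psi> f" if "\<psi> \<in> dual C_r_space" "f \<in> C_r"
    for \<psi> and f :: "'s \<Rightarrow> real" and c
    using that by (auto simp: dual_def)
  show "weak_continuous (\<lambda>_. f)" if "f \<in> C_r" for f :: "'s \<Rightarrow> real"
    using that by (simp add: weak_continuous_iff)
  show "weak_continuous (\<lambda>s t. g s t + h s t)" if "weak_continuous g" "weak_continuous h"
    for g h :: "'s \<Rightarrow> 's \<Rightarrow> real"
    using that by (auto simp: weak_continuous_iff C_r.add_mem dual_add intro!: continuous_on_add)
  show "weak_continuous (\<lambda>s t. c * g s t)" if "weak_continuous g" for g :: "'s \<Rightarrow> 's \<Rightarrow> real" and c
    using that by (auto simp: weak_continuous_iff C_r.scale_mem dual_scale intro!: continuous_on_mult_left)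
  show "weak_continuous g"
    if mem: "\<And>s. g s \<in> C_r"
      and approx: "\<And>\<epsilon>. \<epsilon> > 0 \<Longrightarrow> \<exists>h. weak_continuous h \<and> (\<forall>s t. \<bar>h s t - g s t\<bar> \<le> \<epsilon>)"
    for g :: "'s \<Rightarrow> 's \<Rightarrow> real"
    unfolding weak_continuous_iff
  proof (intro conjI allI ballI mem)
    fix \<psi> :: "('s \<Rightarrow> real) \<Rightarrow> real" assume \<psi>: "\<psi> \<in> dual C_r_space"
    obtain K where K: "K \<ge> 0" "\<And>f. f \<in> C_r \<Longrightarrow> \<bar>\<psi> f\<bar> \<le> K * vnorm C_r_space f"
      using C_r.copy.dual_bounded[OF \<psi>] by auto
    show "continuous_on UNIV (\<lambda>s. \<psi> (g s))"
    proof (rule continuous_on_uniform_approximation)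
      fix \<epsilon> :: real assume "\<epsilon> > 0"
      then have "\<epsilon> / (K + 1) > 0" using K(1) by simp
      then obtain h where h: "weak_continuous h" "\<forall>s t. \<bar>h s t - g s t\<bar> \<le> \<epsilon> / (K + 1)"
        using approx by blast
      have "\<bar>\<psi> (h s) - \<psi> (g s)\<bar> \<le> \<epsilon>" for s
      proof -
        have hs: "h s \<in> C_r" using h(1) by (simp add: weak_continuous_iff)
        have "\<psi> (h s) - \<psi> (g s) = \<psi> (\<lambda>t. h s t - g s t)"
          using C_r.copy.dual_diff[OF \<psi>, of "h s" "g s"] hs mem by (simp add: C_r.diff_copy)
        then have "\<bar>\<psi> (h s) - \<psi> (g s)\<bar> \<le> K * vnorm C_r_space (\<lambda>t. h s t - g s t)"
          using K(2)[OF C_r.diff_mem[OF hs mem[of s]]] by simp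
        also have "\<dots> \<le> K * (\<epsilon> / (K + 1))"
          using h(2) K(1) by (intro mult_left_mono C_r.norm_copy_le) auto
        also have "\<dots> \<le> \<epsilon>" using K(1) \<open>\<epsilon> > 0\<close> by (simp add: pos_divide_le_eq algebra_simps)
        finally show ?thesis .
      qed
      then show "\<exists>h. continuous_on UNIV h \<and> (\<forall>s. \<bar>h s - \<psi> (g s)\<bar> \<le> \<epsilon>)"
        using h(1) \<psi> by (intro exI[of _ "\<lambda>s. \<psi> (h s)"]) (simp add: weak_continuous_iff)
    qed
  qed
qed

interpretation weak: orbit_continuity weak_continuous
  by (rule orbit_continuity_weak)

lemma C_weak_eq: "C_weak = weak.orbit_space"
  by (simp add: C_weak_def weak.orbit_space_def weak_continuous_def)

text \<open>
  Mazur-Orlicz for \<open>K \<parallel>f\<parallel>\<close> and the graph of \<open>\<psi>\<close>. It is needed because the weak topology of the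
  representation space is defined by its own dual, whereas membership in \<open>C_weak\<close> refers to the dual
  of \<open>C_r\<close>.
\<close>

lemma dual_extension:
  fixes F :: "('s::{semigroup_mult, topological_space} \<Rightarrow> real) set"
  assumes copy: "bounded_function_space_copy F e d" and sub: "F \<subseteq> C_r"
    and \<psi>: "\<psi> \<in> dual (function_space_copy e d F)"
  obtains \<psi>' where "\<psi>' \<in> dual C_r_space" "\<And>f. f \<in> F \<Longrightarrow> \<psi>' f = \<psi> (e f)"
proof -
  interpret bounded_function_space_copy F e d by (rule copy)
  interpret real: real_vector_space_on "C_r_space :: (real, 's \<Rightarrow> real) nvs"
    using C_r.copy.real_vector_space_on_underlying_real by simp
  obtain K where K: "K \<ge> 0" "\<And>v. v \<in> carrier Y \<Longrightarrow> norm (\<psi> v) \<le> K * vnorm Y v"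
    using copy.dual_bounded[OF \<psi>] by blast
  have \<psi>_add: "\<psi> (e (\<lambda>t. f t + g t)) = \<psi> (e f) + \<psi> (e g)" if "f \<in> F" "g \<in> F" for f g
    using \<psi> that by (auto simp: dual_def)
  have \<psi>_scale: "\<psi> (e (\<lambda>t. c * f t)) = c * \<psi> (e f)" if "f \<in> F" for f c
    using \<psi> that by (auto simp: dual_def)
  define G where "G = (\<lambda>f. (f, \<psi> (e f))) ` F"
  have p: "sublinear_on C_r_space (\<lambda>f :: 's \<Rightarrow> real. K * vnorm C_r_space f)"
    unfolding sublinear_on_def
  proof (intro conjI ballI allI impI)
    fix f g :: "'s \<Rightarrow> real" assume "f \<in> carrier C_r_space" "g \<in> carrier C_r_space"
    then show "K * vnorm C_r_space (f \<oplus>\<^bsub>C_r_space\<^esub> g) \<le> K * vnorm C_r_space f + K * vnorm C_r_space g"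
      using mult_left_mono[OF C_r.copy.norm_triangle K(1)] by (simp add: distrib_left)
  next
    fix f :: "'s \<Rightarrow> real" and c :: real assume "f \<in> carrier C_r_space" "c > 0"
    then show "K * vnorm C_r_space (c \<odot>\<^bsub>C_r_space\<^esub> f) \<le> c * (K * vnorm C_r_space f)"
      using C_r.copy.norm_scale[of f c] by simp
  qed
  obtain u where u: "linear_on_carrier C_r_space u" "\<And>f. f \<in> carrier C_r_space \<Longrightarrow> u f \<le> K * vnorm C_r_space f"
    "\<And>f a. (f, a) \<in> G \<Longrightarrow> a \<le> u f"
  proof (rule real.mazur_orlicz[OF p, of G], goal_cases)
    case 1
    show ?case using sub by (auto simp: G_def)
  next
    case 2
    show ?case using zero_mem \<psi>_scale[OF zero_mem, of 0] by (auto simp: G_def image_iff)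
  next
    case (3 f a g b)
    then show ?case by (auto simp: G_def \<psi>_add add_mem image_iff)
  next
    case (4 f a c)
    then show ?case by (auto simp: G_def \<psi>_scale scale_mem image_iff)
  next
    case (5 f a)
    then show ?case using K(2)[of "e f"] by (auto simp: G_def abs_le_iff)
  qed blast
  have u_neg: "u (\<lambda>t. - f t) = - u f" if "f \<in> C_r" for f
  proof -
    have "\<forall>c. u (\<lambda>t. c * f t) = c * u f" using u(1) that by (simp add: linear_on_carrier_def)
    from spec[OF this, of "- 1"] show ?thesis by simp
  qed
  show thesis
  proof
    have "\<bar>u f\<bar> \<le> K * vnorm C_r_space f" if f: "f \<in> C_r" for f
      using u(2)[of f] u(2)[of "\<lambda>t. - f t"] u_neg[OF f] C_r.uminus_mem[OF f] f by simp
    then show "u \<in> dual C_r_space"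
      using u(1) by (auto simp: dual_def linear_on_carrier_def)
    fix f assume f: "f \<in> F"
    have "\<psi> (e f) \<le> u f" using u(3) f by (simp add: G_def)
    moreover have "- \<psi> (e f) \<le> - u f"
      using u(3)[of "\<lambda>t. - f t" "\<psi> (e (\<lambda>t. - f t))"] uminus_mem[OF f] \<psi>_scale[OF f, of "- 1"] u_neg[of f] f sub
      by (auto simp: G_def)
    ultimately show "u f = \<psi> (e f)" by simp
  qed
qed

proposition strongly_right_amenable_of_wot_decomposition:
  assumes "decomposition_property wot TYPE(real) TYPE(('x, 's) universe) TYPE('s::{semigroup_mult, topological_space})"
  shows "strongly_right_amenable TYPE('s)"
proof -
  interpret translation_space_copy "weak.orbit_space :: ('s \<Rightarrow> real) set" "Inr :: _ \<Rightarrow> ('x, 's) universe" projr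
    by (rule weak.translation_space_copy_orbit_space) simp
  have "continuous_map euclidean (weak_topology Y) (\<lambda>s. right_translation s v)" if v: "v \<in> carrier Y" for v
    unfolding continuous_map_weak_topology_iff
  proof (intro conjI allI ballI)
    show "right_translation s v \<in> carrier Y" for s using v by (rule shifts.rep_closed)
    obtain f where f: "f \<in> weak.orbit_space" "v = Inr f" using v by auto
    fix \<psi> assume \<psi>: "\<psi> \<in> dual Y"
    obtain \<psi>' where \<psi>': "\<psi>' \<in> dual C_r_space" "\<And>f. f \<in> weak.orbit_space \<Longrightarrow> \<psi>' f = \<psi> (Inr f)"
      using dual_extension[OF bounded_function_space_copy_axioms _ \<psi>] by (auto simp: weak.orbit_space_def)
    have "weak_continuous (\<lambda>s. translate f s)" using f(1) by (simp add: weak.orbit_space_def)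
    then have "continuous_on UNIV (\<lambda>s. \<psi>' (translate f s))" using \<psi>'(1) by (simp add: weak_continuous_iff)
    then show "continuous_on UNIV (\<lambda>s. \<psi> (right_translation s v))"
      using f by (simp add: \<psi>'(2) translate_mem)
  qed
  then have "continuous_map euclidean (wot Y) right_translation"
    using right_translation_bounded
    by (auto simp: wot_def continuous_map_in_subtopology continuous_map_componentwise right_translation_def)
  then have "\<exists>\<phi>. right_invariant_mean_on (weak.orbit_space :: ('s \<Rightarrow> real) set) \<phi>"
    by (rule weak.invariant_mean_on_orbit_space[OF assms])
  then show ?thesis by (simp add: strongly_right_amenable_def C_weak_eq)
qed

section \<open>The equivalence\<close>

theorem corollary4p8:
  shows
    "(strongly_right_amenable TYPE('s::{semigroup_mult, topological_space}) \<longleftrightarrow>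
        decomposition_property wot TYPE(real) TYPE(('x, 's) universe) TYPE('s) \<and>
        decomposition_property wot TYPE(complex) TYPE(('x, 's) universe) TYPE('s)) \<and>
     (weakly_right_amenable TYPE('s) \<longleftrightarrow>
        decomposition_property sot TYPE(real) TYPE(('x, 's) universe) TYPE('s) \<and>
        decomposition_property sot TYPE(complex) TYPE(('x, 's) universe) TYPE('s))"
proof (intro conjI iffI)
  assume "strongly_right_amenable TYPE('s)"
  then show "decomposition_property wot TYPE(real) TYPE(('x, 's) universe) TYPE('s)"
    "decomposition_property wot TYPE(complex) TYPE(('x, 's) universe) TYPE('s)"
    by (auto intro: wot_decomposition_of_strongly_right_amenable
        weakly_continuous_real_functional_real weakly_continuous_real_functional_complex)
next
  assume "weakly_right_amenable TYPE('s)"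
  then show "decomposition_property sot TYPE(real) TYPE(('x, 's) universe) TYPE('s)"
    "decomposition_property sot TYPE(complex) TYPE(('x, 's) universe) TYPE('s)"
    by (auto intro: sot_decomposition_of_weakly_right_amenable)
next
  assume "decomposition_property wot TYPE(real) TYPE(('x, 's) universe) TYPE('s) \<and>
    decomposition_property wot TYPE(complex) TYPE(('x, 's) universe) TYPE('s)"
  then show "strongly_right_amenable TYPE('s)"
    using strongly_right_amenable_of_wot_decomposition by blast
next
  assume "decomposition_property sot TYPE(real) TYPE(('x, 's) universe) TYPE('s) \<and>
    decomposition_property sot TYPE(complex) TYPE(('x, 's) universe) TYPE('s)"
  then show "weakly_right_amenable TYPE('s)"
    using weakly_right_amenable_of_sot_decomposition by blast
qed

end
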